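(* Let $m\ge 2$ and $n\ge 2$ be natural numbers, and let $k\in\mathbb{N}$ be such that $k<n$ and $\gcd(n,k)=1$. Then there exists a dense set of $\alpha$ in $I_{n,k}(\sqrt[n]{\beta_m})$ such that $\Omega_{\sqrt[n]{\beta_m},\alpha}$ is a subshift of finite type. Moreover, if $\beta\in(1,2)$ is a Pisot number, then there exists a dense set of $\alpha$ in $I_{n,k}(\sqrt[n]{\beta})$ such that $\Omega_{\sqrt[n]{\beta},\alpha}$ is sofic.
   Context: For an integer $m\ge 2$, the multinacci number $\beta_m$ is the unique real solution in $(1,2)$ of $x^m = x^{m-1}+\dots+x+1$. A Pisot number is a real algebraic integer greater than $1$ all of whose other Galois conjugates have modulus strictly less than $1$. Intervals $I_{n,k}$. Let $n,k\in\mathbb{N}$ with $k<n$, $\gcd(n,k)=1$, and write $n=\ell k+s$ with $\ell\in\mathbb{N}$ and $s\in\{0,\dots,k-1\}$. For $j\in\{1,\dots,s\}$ define integers $V_j,r_j$ by $jk=V_j s+r_j$ with $r_j\in\{0,\dots,s-1\}$, and define $h_j$ by $V_j=h_1+\dots+h_j$. For $b\in(1,2^{1/n}]$ put $$W_1=\sum_{i=1}^{V_1} b^{(V_s-i)\ell+s-1},\qquad W_j=\sum_{i=1}^{h_j} b^{(V_s-V_{j-1}-i)\ell+s-j}\quad(2\le j\le s),$$ $$I_{n,1}(b)=\left[\frac{1}{b(b^{n-1}+\dots+1)},\ \frac{-b^{n+1}+b^n+2b-1}{b(b^{n-1}+\dots+1)}\right],$$ and, for $k\geq 2$, $$I_{n,k}(b)=\left[\frac{1+b\left(\sum_{j=1}^s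 W_j-1\right)}{b(b^{n-1}+\dots+1)},\ \frac{b\left(\sum_{j=1}^s W_j\right)-b^{n+1}+b^n+b-1}{b(b^{n-1}+\dots+1)}\right].$$ Shifts. For $b\in(1,2)$ and $\alpha\in[0,2-b]$ put $p=(1-\alpha)/b$ and $J_{b,\alpha}=[-\alpha/(b-1),(1-\alpha)/(b-1)]$. The maps $T^{\pm}_{b,\alpha}:J_{b,\alpha}\to J_{b,\alpha}$ are: $T^+_{b,\alpha}(x)=b x+\alpha$ if $x<p$ and $b x+\alpha-1$ otherwise; $T^-_{b,\alpha}(x)=b x+\alpha$ if $x\le p$ and $b x+\alpha-1$ otherwise. The expansion maps $\tau^{\pm}_{b,\alpha}:J_{b,\alpha}\to\{0,1\}^{\mathbb{N}}$ are $\tau^{\pm}_{b,\alpha}(x)=(\omega_1^{\pm}(x),\omega_2^{\pm}(x),\dots)$, where $\omega_i^+(x)=0$ if $(T^+_{b,\alpha})^{i-1}(x)<p$ and $1$ otherwise, and $\omega_i^-(x)=0$ if $(T^-_{b,\alpha})^{i-1}(x)\le p$ and $1$ otherwise. Set $\Omega^{\pm}_{b,\alpha}=\tau^{\pm}_{b,\alpha}(J_{b,\alpha})$ and $\Omega_{b,\alpha}=\Omega^+_{b,\alpha}\cup\Omega^-_{b,\alpha}$, a subshift of $\{0,1\}^{\mathbb{N}}$ (closed in the product topology and invariant under the left shift). A subshift is of finite type if it is the set of all infinite words avoiding some finite set of finite (forbidden) words; a subshift is sofic if it is a factor (image under a continuous shift-commuting surjection) of a subshift of finite type. *)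

theory Defs
  imports "HOL-Analysis.Analysis" "HOL-Computational_Algebra.Computational_Algebra"
begin

section \<open>Multinacci and Pisot numbers\<close>

definition multinacci :: "nat \<Rightarrow> real" where
  "multinacci m = (THE x. 1 < x \<and> x < 2 \<and> x ^ m = (\<Sum>i<m. x ^ i))"

text \<open>The witness \<open>p\<close> is the minimal polynomial of \<open>x\<close> over the rationals.\<close>

definition galois_conjugate :: "complex \<Rightarrow> complex \<Rightarrow> bool" where
  "galois_conjugate x z \<longleftrightarrow>
     (\<exists>p :: rat poly. lead_coeff p = 1 \<and> irreducible p \<and>
        poly (map_poly of_rat p) x = 0 \<and> poly (map_poly of_rat p) z = 0)"

definition pisot :: "real \<Rightarrow> bool" where
  "pisot \<beta> \<longleftrightarrow> algebraic_int \<beta> \<and> 1 < \<beta> \<and>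
     (\<forall>z. galois_conjugate (complex_of_real \<beta>) z \<and> z \<noteq> complex_of_real \<beta> \<longrightarrow> cmod z < 1)"

section \<open>The parameter intervals\<close>

text \<open>Throughout, \<open>\<ell> = n div k\<close> and \<open>s = n mod k\<close>, so that \<open>n = \<ell> k + s\<close>.\<close>

definition V :: "nat \<Rightarrow> nat \<Rightarrow> nat \<Rightarrow> nat" where
  "V n k j = (j * k) div (n mod k)"

text \<open>Since \<open>V n k 0 = 0\<close>, the case \<open>j = 1\<close> needs no separate treatment in the next two
  definitions: \<open>h\<^sub>1 = V\<^sub>1\<close> and \<open>W\<^sub>1\<close> has exponents \<open>(V\<^sub>s - i) \<ell> + s - 1\<close>.\<close>

definition h :: "nat \<Rightarrow> nat \<Rightarrow> nat \<Rightarrow> nat" where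
  "h n k j = V n k j - V n k (j - 1)"

text \<open>For \<open>1 \<le> j \<le> s\<close> and \<open>1 \<le> i \<le> h\<^sub>j\<close> one has \<open>V\<^bsub>j-1\<^esub> + i \<le> V\<^sub>j \<le> V\<^sub>s\<close>, so the subtractions in the
  exponent do not truncate.\<close>

definition W :: "nat \<Rightarrow> nat \<Rightarrow> real \<Rightarrow> nat \<Rightarrow> real" where
  "W n k b j =
     (\<Sum>i = 1..h n k j. b ^ ((V n k (n mod k) - V n k (j - 1) - i) * (n div k) + (n mod k - j)))"

definition param_interval :: "nat \<Rightarrow> nat \<Rightarrow> real \<Rightarrow> real set" where
  "param_interval n k b =
     (let d = b * (\<Sum>i<n. b ^ i); S = (\<Sum>j = 1..n mod k. W n k b j) in
      if k = 1 then {1 / d .. (- (b ^ (n + 1)) + b ^ n + 2 * b - 1) / d}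
      else {(1 + b * (S - 1)) / d .. (b * S - b ^ (n + 1) + b ^ n + b - 1) / d})"

section \<open>Intermediate beta-shifts\<close>

definition crit :: "real \<Rightarrow> real \<Rightarrow> real" where
  "crit b \<alpha> = (1 - \<alpha>) / b"

definition J :: "real \<Rightarrow> real \<Rightarrow> real set" where
  "J b \<alpha> = {- \<alpha> / (b - 1) .. (1 - \<alpha>) / (b - 1)}"

text \<open>The maps are given by their formulas on all of \<open>\<real>\<close>; for \<open>0 \<le> \<alpha> \<le> 2 - b\<close> they send \<open>J b \<alpha>\<close>
  into itself, and only points of \<open>J b \<alpha>\<close> enter the shift spaces below.\<close>

definition T_plus :: "real \<Rightarrow> real \<Rightarrow> real \<Rightarrow> real" where
  "T_plus b \<alpha> x = (if x < crit b \<alpha> then b * x + \<alpha> else b * x + \<alpha> - 1)"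

definition T_minus :: "real \<Rightarrow> real \<Rightarrow> real \<Rightarrow> real" where
  "T_minus b \<alpha> x = (if x \<le> crit b \<alpha> then b * x + \<alpha> else b * x + \<alpha> - 1)"

text \<open>Infinite words are indexed from \<open>0\<close>: entry \<open>i\<close> is the letter \<open>\<omega>\<^bsub>i+1\<^esub>\<close> of the usual notation.\<close>

definition expansion_plus :: "real \<Rightarrow> real \<Rightarrow> real \<Rightarrow> nat \<Rightarrow> nat" where
  "expansion_plus b \<alpha> x i = (if (T_plus b \<alpha> ^^ i) x < crit b \<alpha> then 0 else 1)"

definition expansion_minus :: "real \<Rightarrow> real \<Rightarrow> real \<Rightarrow> nat \<Rightarrow> nat" where
  "expansion_minus b \<alpha> x i = (if (T_minus b \<alpha> ^^ i) x \<le> crit b \<alpha> then 0 else 1)"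

definition \<Omega> :: "real \<Rightarrow> real \<Rightarrow> (nat \<Rightarrow> nat) set" where
  "\<Omega> b \<alpha> = expansion_plus b \<alpha> ` J b \<alpha> \<union> expansion_minus b \<alpha> ` J b \<alpha>"

section \<open>Subshifts\<close>

text \<open>Alphabets are finite sets \<open>A\<close> of natural numbers. The type \<open>nat \<Rightarrow> nat\<close> carries the product
  topology with discrete factors; the full shift over a finite \<open>A\<close> is closed in it, and inherits
  the product topology of the discrete space \<open>A\<close>.\<close>

definition full_shift :: "nat set \<Rightarrow> (nat \<Rightarrow> nat) set" where
  "full_shift A = {\<omega>. range \<omega> \<subseteq> A}"

definition shift :: "(nat \<Rightarrow> nat) \<Rightarrow> nat \<Rightarrow> nat" where
  "shift \<omega> i = \<omega> (Suc i)"

definition occurs :: "nat list \<Rightarrow> (nat \<Rightarrow> nat) \<Rightarrow> bool" where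
  "occurs u \<omega> \<longleftrightarrow> (\<exists>i. map \<omega> [i..<i + length u] = u)"

definition subshift :: "nat set \<Rightarrow> (nat \<Rightarrow> nat) set \<Rightarrow> bool" where
  "subshift A X \<longleftrightarrow> finite A \<and> X \<subseteq> full_shift A \<and> closed X \<and> shift ` X \<subseteq> X"

definition subshift_of_finite_type :: "nat set \<Rightarrow> (nat \<Rightarrow> nat) set \<Rightarrow> bool" where
  "subshift_of_finite_type A X \<longleftrightarrow> subshift A X \<and>
     (\<exists>F. finite F \<and> F \<subseteq> lists A \<and> X = {\<omega> \<in> full_shift A. \<forall>u\<in>F. \<not> occurs u \<omega>})"

text \<open>The covering shift of finite type may use a different, larger alphabet \<open>B\<close>.\<close>

definition sofic :: "nat set \<Rightarrow> (nat \<Rightarrow> nat) set \<Rightarrow> bool" where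
  "sofic A X \<longleftrightarrow> subshift A X \<and>
     (\<exists>B Y \<pi>. subshift_of_finite_type B Y \<and> continuous_on Y \<pi> \<and> \<pi> ` Y = X \<and>
        (\<forall>\<omega>\<in>Y. \<pi> (shift \<omega>) = shift (\<pi> \<omega>)))"

section \<open>Dense subsets\<close>

definition dense_subset :: "real set \<Rightarrow> real set \<Rightarrow> bool" where
  "dense_subset D S \<longleftrightarrow> D \<subseteq> S \<and> S \<subseteq> closure D"

end

theory Submission
  imports Defs "HOL-Library.Nat_Bijection"
begin

text \<open>Let \<open>p\<close> be the critical point. The shift \<open>\<Omega> b \<alpha>\<close> consists of the words all of whose tails lie
  lexicographically below the lower expansion of \<open>p\<close> (if they begin with \<open>0\<close>) or above the upper one
  (if they begin with \<open>1\<close>). Hence it is of finite type if both expansions of \<open>p\<close> are periodic and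
  sofic if both are eventually periodic.

  With \<open>S = \<Sum>\<^sub>j W\<^sub>j\<close>, the digits of \<open>S\<close> are those of the rotation by \<open>k / n\<close>, and the interior of the
  parameter interval is the set of \<open>\<alpha>\<close> for which the \<open>n\<close>-th iterate maps the interval \<open>[u, v]\<close> spanned by
  the two \<open>n\<close>-th images of \<open>p\<close> into itself. On \<open>[u, v]\<close> this iterate is, up to scaling, again such a
  transformation, now with slope \<open>b ^ n\<close>.

  If \<open>b ^ n\<close> is the \<open>m\<close>-th multinacci number, the two orbits of \<open>p\<close> merge after \<open>m\<close> steps of the
  renormalised map. Since orbits are expanded when \<open>\<alpha>\<close> varies, a dense set of \<open>\<alpha>\<close> makes the orbit of
  \<open>0\<close> return to \<open>p\<close>, and to do so only after merging; then both orbits of \<open>p\<close> are periodic. If \<open>b ^ n\<close>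
  is a Pisot number and the translation part of the renormalised map is rational, the orbits of \<open>p\<close>
  stay in a lattice with bounded conjugates, so they are finite.\<close>

section \<open>Lexicographically constrained words\<close>

text \<open>That the blocks \<open>[x j, y j]\<close> visited by \<open>[u, v]\<close> do not
  overlap is not assumed; two strict inequalities constrain the last block only. Disjointness
  follows by expansion: an overlap of neighbours would lead to an overlap at least \<open>b\<close>
  times as large, although there are only finitely many pairs of neighbours. These inequalities are
  strict, so the dynamics is analysed in the interior of the parameter interval; closure supplies
  the endpoints. For multinacci slopes the obstacle is that a return of 0 to \<open>p\<close> before
  the orbits merge says nothing about the other orbit. Such early returns occur for finitely many
  \<alpha> only and can be avoided. For Pisot slopes density has another source: the translation
  part of the renormalised map is a nonconstant affine function of \<alpha>, so it is rational on a
  dense set.\<close>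

definition lex_le :: "(nat \<Rightarrow> nat) \<Rightarrow> (nat \<Rightarrow> nat) \<Rightarrow> bool" where
  "lex_le x y \<longleftrightarrow> (\<forall>j. (\<forall>i<j. x i = y i) \<longrightarrow> x j \<le> y j)"

definition admissible :: "(nat \<Rightarrow> nat) \<Rightarrow> (nat \<Rightarrow> nat) \<Rightarrow> (nat \<Rightarrow> nat) set" where
  "admissible \<kappa> \<kappa>' = {\<omega> \<in> full_shift {0, 1}. \<forall>i.
     (\<omega> i = 0 \<longrightarrow> lex_le (\<lambda>j. \<omega> (i + j)) \<kappa>) \<and> (\<omega> i = 1 \<longrightarrow> lex_le \<kappa>' (\<lambda>j. \<omega> (i + j)))}"

lemma lex_le_refl [simp]: "lex_le x x"
  by (simp add: lex_le_def)

lemma lex_le_head: "lex_le x y \<Longrightarrow> x 0 \<le> y 0"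
  by (simp add: lex_le_def)

lemma lex_le_tail: "lex_le x y \<Longrightarrow> x 0 = y 0 \<Longrightarrow> lex_le (\<lambda>j. x (Suc j)) (\<lambda>j. y (Suc j))"
  unfolding lex_le_def
  by (metis less_Suc_eq_0_disj)

lemma not_lex_le_D:
  assumes "\<not> lex_le x y"
  obtains j where "\<forall>i<j. x i = y i" "y j < x j"
  using assms unfolding lex_le_def by (meson not_le)

lemma lex_le_neq_D:
  assumes "lex_le x y" "x \<noteq> y"
  obtains j where "\<forall>i<j. x i = y i" "x j < y j"
proof -
  define j where "j = (LEAST j. x j \<noteq> y j)"
  from assms(2) have "\<exists>j. x j \<noteq> y j" by auto
  then have "x j \<noteq> y j" unfolding j_def by (rule LeastI_ex)
  moreover have "\<forall>i<j. x i = y i" unfolding j_def using not_less_Least by blast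
  ultimately show thesis using assms(1) that unfolding lex_le_def by (metis le_neq_implies_less)
qed

lemma open_cylinder: "open {\<omega>' :: nat \<Rightarrow> nat. \<forall>i<N. \<omega>' i = \<omega> i}"
proof -
  have "{\<omega>' :: nat \<Rightarrow> nat. \<forall>i<N. \<omega>' i = \<omega> i} = (\<Inter>i\<in>{..<N}. (\<lambda>\<omega>'. \<omega>' i) -` {\<omega> i})"
    by auto
  also have "open \<dots>"
    by (intro open_INT ballI open_vimage continuous_on_product_coordinates open_discrete) auto
  finally show ?thesis .
qed

text \<open>Cylinders are open, so a complement whose points are all excluded by a finite prefix is
  a union of open sets.\<close>

lemma closed_if_finitely_refutable:
  fixes X :: "(nat \<Rightarrow> nat) set"
  assumes "\<And>\<omega>. \<omega> \<notin> X \<Longrightarrow> \<exists>N. \<forall>\<omega>'. (\<forall>i<N. \<omega>' i = \<omega> i) \<longrightarrow> \<omega>' \<notin> X"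
  shows "closed X"
  unfolding closed_def
proof (subst open_subopen, intro ballI)
  fix \<omega> assume "\<omega> \<in> - X"
  then obtain N where "\<forall>\<omega>'. (\<forall>i<N. \<omega>' i = \<omega> i) \<longrightarrow> \<omega>' \<notin> X" using assms[of \<omega>] by blast
  then show "\<exists>T. open T \<and> \<omega> \<in> T \<and> T \<subseteq> - X"
    by (intro exI[of _ "{\<omega>'. \<forall>i<N. \<omega>' i = \<omega> i}"]) (auto simp: open_cylinder)
qed

lemma admissible_in: "\<omega> \<in> admissible \<kappa> \<kappa>' \<Longrightarrow> \<omega> i \<in> {0, 1}"
  by (auto simp: admissible_def full_shift_def)

lemma closed_admissible: "closed (admissible \<kappa> \<kappa>')"
proof (rule closed_if_finitely_refutable)
  fix \<omega> assume *: "\<omega> \<notin> admissible \<kappa> \<kappa>'"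
  consider i where "\<omega> i \<notin> {0, 1}"
    | i where "\<omega> i = 0" "\<not> lex_le (\<lambda>j. \<omega> (i + j)) \<kappa>"
    | i where "\<omega> i = 1" "\<not> lex_le \<kappa>' (\<lambda>j. \<omega> (i + j))"
    using * by (fastforce simp: admissible_def full_shift_def image_subset_iff)
  then show "\<exists>N. \<forall>\<omega>'. (\<forall>i<N. \<omega>' i = \<omega> i) \<longrightarrow> \<omega>' \<notin> admissible \<kappa> \<kappa>'"
  proof cases
    case (1 i)
    then show ?thesis
      by (intro exI[of _ "Suc i"]) (metis admissible_in lessI)
  next
    case (2 i)
    from 2(2) obtain j where j: "\<forall>l<j. \<omega> (i + l) = \<kappa> l" "\<kappa> j < \<omega> (i + j)"
      by (rule not_lex_le_D)
    have "\<omega>' \<notin> admissible \<kappa> \<kappa>'" if eq: "\<forall>l<Suc (i + j). \<omega>' l = \<omega> l" for \<omega>'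
    proof
      assume "\<omega>' \<in> admissible \<kappa> \<kappa>'"
      moreover have "\<omega>' i = 0" using 2 eq by simp
      ultimately have "lex_le (\<lambda>j. \<omega>' (i + j)) \<kappa>" by (simp add: admissible_def)
      moreover have "\<forall>l<j. \<omega>' (i + l) = \<kappa> l" using j eq by simp
      ultimately have "\<omega>' (i + j) \<le> \<kappa> j" by (simp add: lex_le_def)
      then show False using j eq by simp
    qed
    then show ?thesis by blast
  next
    case (3 i)
    from 3(2) obtain j where j: "\<forall>l<j. \<kappa>' l = \<omega> (i + l)" "\<omega> (i + j) < \<kappa>' j"
      by (rule not_lex_le_D)
    have "\<omega>' \<notin> admissible \<kappa> \<kappa>'" if eq: "\<forall>l<Suc (i + j). \<omega>' l = \<omega> l" for \<omega>'
    proof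
      assume "\<omega>' \<in> admissible \<kappa> \<kappa>'"
      moreover have "\<omega>' i = 1" using 3 eq by simp
      ultimately have "lex_le \<kappa>' (\<lambda>j. \<omega>' (i + j))" by (simp add: admissible_def)
      moreover have "\<forall>l<j. \<kappa>' l = \<omega>' (i + l)" using j eq by simp
      ultimately have "\<kappa>' j \<le> \<omega>' (i + j)" by (simp add: lex_le_def)
      then show False using j eq by simp
    qed
    then show ?thesis by blast
  qed
qed

lemma subshift_admissible: "subshift {0, 1} (admissible \<kappa> \<kappa>')"
proof -
  have "shift \<omega> \<in> admissible \<kappa> \<kappa>'" if "\<omega> \<in> admissible \<kappa> \<kappa>'" for \<omega>
  proof -
    have "shift \<omega> \<in> full_shift {0, 1}"
      using admissible_in[OF that] by (simp add: full_shift_def shift_def image_subset_iff)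
    moreover have "(shift \<omega> i = 0 \<longrightarrow> lex_le (\<lambda>j. shift \<omega> (i + j)) \<kappa>) \<and>
        (shift \<omega> i = 1 \<longrightarrow> lex_le \<kappa>' (\<lambda>j. shift \<omega> (i + j)))" for i
      using that by (auto simp: admissible_def shift_def dest!: spec[of _ "Suc i"])
    ultimately show ?thesis by (auto simp: admissible_def)
  qed
  then show ?thesis
    unfolding subshift_def using closed_admissible by (auto simp del: One_nat_def) (simp add: admissible_def)
qed

text \<open>A forbidden word shows a violation with first disagreement at \<open>j \<le> N\<close>.
  A violation at \<open>j > N\<close> reduces to one at \<open>j - N\<close>: the word agrees with
  \<open>\<kappa>\<close> beyond position \<open>N\<close>, where
  \<open>\<kappa> N = \<kappa> 0 = 0\<close>, so the tail starting \<open>N\<close> letters later is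
  under the same constraint and violates it by periodicity; likewise for \<open>\<kappa>'\<close>.
  The descent does not cover \<open>j = N\<close>, hence words of length
  \<open>Suc N\<close>.\<close>

lemma subshift_of_finite_type_admissible:
  assumes "0 < N" and per: "\<And>i. \<kappa> (i + N) = \<kappa> i" "\<And>i. \<kappa>' (i + N) = \<kappa>' i"
    and "\<kappa> 0 = 0" "\<kappa>' 0 = 1"
  shows "subshift_of_finite_type {0, 1} (admissible \<kappa> \<kappa>')"
proof -
  define F where "F = {u. set u \<subseteq> {0, 1} \<and> length u = Suc N \<and> (\<exists>j\<le>N.
      (u ! 0 = 0 \<and> (\<forall>i<j. u ! i = \<kappa> i) \<and> \<kappa> j < u ! j) \<or>
      (u ! 0 = 1 \<and> (\<forall>i<j. u ! i = \<kappa>' i) \<and> u ! j < \<kappa>' j))}"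
  have "finite F"
    by (rule finite_subset[OF _ finite_lists_length_eq[of "{0, 1}" "Suc N"]]) (auto simp: F_def)
  moreover have "F \<subseteq> lists {0, 1}" by (auto simp: F_def)
  moreover have "admissible \<kappa> \<kappa>' = {\<omega> \<in> full_shift {0, 1}. \<forall>u\<in>F. \<not> occurs u \<omega>}"
  proof (intro set_eqI iffI)
    fix \<omega> assume adm: "\<omega> \<in> admissible \<kappa> \<kappa>'"
    have "\<not> occurs u \<omega>" if "u \<in> F" for u
    proof
      assume "occurs u \<omega>"
      then obtain i where "map \<omega> [i..<i + length u] = u" by (auto simp: occurs_def)
      then have nth: "u ! l = \<omega> (i + l)" if "l \<le> N" for l
        using that \<open>u \<in> F\<close> unfolding F_def
        by (smt (verit) add_diff_cancel_left' le_imp_less_Suc length_upt mem_Collect_eq nth_map nth_upt nat_add_left_cancel_less)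
      from \<open>u \<in> F\<close> obtain j where "j \<le> N" and j: "(u ! 0 = 0 \<and> (\<forall>i<j. u ! i = \<kappa> i) \<and> \<kappa> j < u ! j) \<or>
          (u ! 0 = 1 \<and> (\<forall>i<j. u ! i = \<kappa>' i) \<and> u ! j < \<kappa>' j)" by (auto simp: F_def)
      from j show False
      proof
        assume a: "u ! 0 = 0 \<and> (\<forall>i<j. u ! i = \<kappa> i) \<and> \<kappa> j < u ! j"
        then have "lex_le (\<lambda>j. \<omega> (i + j)) \<kappa>" using adm nth[of 0] by (simp add: admissible_def)
        then have "(\<forall>l<j. \<omega> (i + l) = \<kappa> l) \<longrightarrow> \<omega> (i + j) \<le> \<kappa> j"
          unfolding lex_le_def by blast
        then show False using a \<open>j \<le> N\<close> by (auto simp: nth)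
      next
        assume a: "u ! 0 = 1 \<and> (\<forall>i<j. u ! i = \<kappa>' i) \<and> u ! j < \<kappa>' j"
        then have "lex_le \<kappa>' (\<lambda>j. \<omega> (i + j))" using adm nth[of 0] by (simp add: admissible_def)
        then have "(\<forall>l<j. \<kappa>' l = \<omega> (i + l)) \<longrightarrow> \<kappa>' j \<le> \<omega> (i + j)"
          unfolding lex_le_def by blast
        then show False using a \<open>j \<le> N\<close> by (auto simp: nth)
      qed
    qed
    with adm show "\<omega> \<in> {\<omega> \<in> full_shift {0, 1}. \<forall>u\<in>F. \<not> occurs u \<omega>}"
      by (auto simp: admissible_def)
  next
    fix \<omega> assume "\<omega> \<in> {\<omega> \<in> full_shift {0, 1}. \<forall>u\<in>F. \<not> occurs u \<omega>}"
    then have fs: "\<omega> \<in> full_shift {0, 1}" and noF: "\<And>u. u \<in> F \<Longrightarrow> \<not> occurs u \<omega>" by auto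
    have bin: "\<omega> i = Suc 0" if "0 < \<omega> i" for i
    proof -
      have "\<omega> i \<in> {0, 1}" using fs by (simp add: full_shift_def image_subset_iff)
      then show ?thesis using that by auto
    qed
    have word: "map \<omega> [i..<i + Suc N] \<notin> F" for i
      using noF[of "map \<omega> [i..<i + Suc N]"] by (auto simp: occurs_def simp del: upt_Suc)
    have lower: "\<omega> (i + j) \<le> \<kappa> j" if "\<omega> i = 0" "\<forall>l<j. \<omega> (i + l) = \<kappa> l" for i j
      using that
    proof (induction j arbitrary: i rule: less_induct)
      case (less j)
      show ?case
      proof (cases "j \<le> N")
        case True
        show ?thesis
        proof (rule ccontr)
          assume "\<not> \<omega> (i + j) \<le> \<kappa> j"
          then have "map \<omega> [i..<i + Suc N] \<in> F"
            using less.prems True bin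
            by (auto simp: F_def simp del: upt_Suc intro!: exI[of _ j])
          with word show False by blast
        qed
      next
        case False
        have "\<omega> (i + N) = \<kappa> (0 + N)" using less.prems False by auto
        then have "\<omega> (i + N) = 0" using per(1)[of 0] assms by simp
        moreover have "\<omega> (i + N + l) = \<kappa> l" if "l < j - N" for l
          using less.prems(2)[rule_format, of "N + l"] that per(1)[of l] by (simp add: add_ac)
        ultimately have "\<omega> (i + N + (j - N)) \<le> \<kappa> (j - N)"
          using less.IH[of "j - N" "i + N"] \<open>0 < N\<close> False by auto
        then show ?thesis using per(1)[of "j - N"] False by (simp add: add_ac)
      qed
    qed
    have upper: "\<kappa>' j \<le> \<omega> (i + j)" if "\<omega> i = 1" "\<forall>l<j. \<omega> (i + l) = \<kappa>' l" for i j
      using that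
    proof (induction j arbitrary: i rule: less_induct)
      case (less j)
      show ?case
      proof (cases "j \<le> N")
        case True
        show ?thesis
        proof (rule ccontr)
          assume "\<not> \<kappa>' j \<le> \<omega> (i + j)"
          then have "map \<omega> [i..<i + Suc N] \<in> F"
            using less.prems True bin
            by (auto simp: F_def simp del: upt_Suc intro!: exI[of _ j])
          with word show False by blast
        qed
      next
        case False
        have "\<omega> (i + N) = \<kappa>' (0 + N)" using less.prems False by auto
        then have "\<omega> (i + N) = 1" using per(2)[of 0] assms by simp
        moreover have "\<omega> (i + N + l) = \<kappa>' l" if "l < j - N" for l
          using less.prems(2)[rule_format, of "N + l"] that per(2)[of l] by (simp add: add_ac)
        ultimately have "\<kappa>' (j - N) \<le> \<omega> (i + N + (j - N))"
          using less.IH[of "j - N" "i + N"] \<open>0 < N\<close> False by auto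
        then show ?thesis using per(2)[of "j - N"] False by (simp add: add_ac)
      qed
    qed
    show "\<omega> \<in> admissible \<kappa> \<kappa>'"
      unfolding admissible_def lex_le_def
    proof (intro CollectI conjI allI impI)
      fix i j
      show "\<omega> (i + j) \<le> \<kappa> j" if "\<omega> i = 0" "\<forall>l<j. \<omega> (i + l) = \<kappa> l"
        using that by (rule lower)
      show "\<kappa>' j \<le> \<omega> (i + j)" if "\<omega> i = 1" "\<forall>l<j. \<kappa>' l = \<omega> (i + l)"
        using that by (intro upper) auto
    qed (rule fs)
  qed
  ultimately show ?thesis
    unfolding subshift_of_finite_type_def using subshift_admissible by (intro conjI exI[of _ F])
qed

text \<open>A one-step Markov condition: the forbidden words are the pairs that \<open>ok\<close>
  rejects. It provides the covering shift in the sofic case, where the letters carry the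
  memory.\<close>

lemma subshift_of_finite_type_two_letter:
  assumes "finite B"
  shows "subshift_of_finite_type B {\<eta> \<in> full_shift B. \<forall>i. ok (\<eta> i) (\<eta> (Suc i))}" (is "subshift_of_finite_type B ?Y")
proof -
  have "closed ?Y"
  proof (rule closed_if_finitely_refutable)
    fix \<omega> assume "\<omega> \<notin> ?Y"
    then obtain i where i: "\<omega> i \<notin> B \<or> \<not> ok (\<omega> i) (\<omega> (Suc i))"
      by (auto simp: full_shift_def)
    have "\<omega>' \<notin> ?Y" if "\<forall>l<Suc (Suc i). \<omega>' l = \<omega> l" for \<omega>'
    proof
      assume "\<omega>' \<in> ?Y"
      then have "\<omega>' i \<in> B" "ok (\<omega>' i) (\<omega>' (Suc i))" by (auto simp: full_shift_def)
      then show False using that i by simp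
    qed
    then show "\<exists>N. \<forall>\<omega>'. (\<forall>i<N. \<omega>' i = \<omega> i) \<longrightarrow> \<omega>' \<notin> ?Y" by blast
  qed
  moreover have "shift ` ?Y \<subseteq> ?Y" by (auto simp: shift_def full_shift_def)
  moreover define F where "F = {[x, y] | x y. x \<in> B \<and> y \<in> B \<and> \<not> ok x y}"
  have "finite F"
    by (rule finite_subset[of _ "(\<lambda>(x, y). [x, y]) ` (B \<times> B)"]) (auto simp: F_def assms)
  moreover have "F \<subseteq> lists B" by (auto simp: F_def)
  moreover have occ: "occurs [x, y] \<omega> \<longleftrightarrow> (\<exists>i. \<omega> i = x \<and> \<omega> (Suc i) = y)" for x y \<omega>
    by (auto simp: occurs_def)
  have "(\<forall>u\<in>F. \<not> occurs u \<omega>) \<longleftrightarrow> (\<forall>i. ok (\<omega> i) (\<omega> (Suc i)))"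
    if "\<omega> \<in> full_shift B" for \<omega>
  proof
    assume noF: "\<forall>u\<in>F. \<not> occurs u \<omega>"
    show "\<forall>i. ok (\<omega> i) (\<omega> (Suc i))"
    proof (rule allI, rule ccontr)
      fix i assume "\<not> ok (\<omega> i) (\<omega> (Suc i))"
      then have "[\<omega> i, \<omega> (Suc i)] \<in> F" using that by (auto simp: F_def full_shift_def)
      then show False using noF occ by blast
    qed
  qed (auto simp: F_def occ)
  then have "?Y = {\<omega> \<in> full_shift B. \<forall>u\<in>F. \<not> occurs u \<omega>}" by blast
  moreover have "?Y \<subseteq> full_shift B" by blast
  ultimately show ?thesis
    unfolding subshift_of_finite_type_def subshift_def using assms by (intro conjI exI[of _ F])
qed

text \<open>A letter of the covering shift is a letter \<open>a\<close> of the admissible word together with a set of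
  tails of \<open>\<kappa>\<close> that bound the remaining word from above and a set of tails of \<open>\<kappa>'\<close> that bound it
  from below; \<open>j\<close> stands for the tail that starts at \<open>j\<close>.\<close>

lemma sofic_admissible:
  assumes "0 < N" and per: "\<And>i. M \<le> i \<Longrightarrow> \<kappa> (i + N) = \<kappa> i" "\<And>i. M \<le> i \<Longrightarrow> \<kappa>' (i + N) = \<kappa>' i"
  shows "sofic {0, 1} (admissible \<kappa> \<kappa>')"
proof -
  define enc where "enc = (\<lambda>(a, A, C). prod_encode (a, prod_encode (set_encode A, set_encode C)))"
  define let' where "let' x = fst (prod_decode x)" for x
  define up where "up x = set_decode (fst (prod_decode (snd (prod_decode x))))" for x
  define lo where "lo x = set_decode (snd (prod_decode (snd (prod_decode x))))" for x
  have [simp]: "let' (enc (a, A, C)) = a" for a A C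
    by (simp add: let'_def enc_def)
  have [simp]: "up (enc (a, A, C)) = A" if "finite A" for a A C
    using that by (simp add: up_def enc_def)
  have [simp]: "lo (enc (a, A, C)) = C" if "finite C" for a A C
    using that by (simp add: lo_def enc_def)
  \<comment> \<open>From \<open>M\<close> on, tails that start \<open>N\<close> apart coincide, so
    the indices below \<open>M + N\<close> represent all tails and the successor of the last index
    is \<open>M\<close>.\<close>
  define nxt where "nxt j = (if Suc j = M + N then M else Suc j)" for j
  have nxt_less: "nxt j < M + N" if "j < M + N" for j
    using that \<open>0 < N\<close> by (auto simp: nxt_def)
  have tail: "\<kappa> (nxt j + i) = \<kappa> (Suc (j + i))" "\<kappa>' (nxt j + i) = \<kappa>' (Suc (j + i))" for i j
  proof -
    have "\<kappa> (nxt j + i) = \<kappa> (Suc j + i) \<and> \<kappa>' (nxt j + i) = \<kappa>' (Suc j + i)"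
    proof (cases "Suc j = M + N")
      case True
      then have "Suc j + i = (M + i) + N" "nxt j = M" by (auto simp: nxt_def)
      then show ?thesis using per[of "M + i"] by (simp only: le_add1)
    qed (simp add: nxt_def)
    then show "\<kappa> (nxt j + i) = \<kappa> (Suc (j + i))" "\<kappa>' (nxt j + i) = \<kappa>' (Suc (j + i))" by simp_all
  qed
  \<comment> \<open>A letter 0 or 1 opens a bound by the whole word \<open>\<kappa>\<close> or
    \<open>\<kappa>'\<close>, recorded as index 0. A strict inequality settles a bound for good;
    equality passes it on as the next tail.\<close>
  define ok where "ok x y \<longleftrightarrow> (let' x = 0 \<longrightarrow> 0 \<in> up x) \<and> (let' x = 1 \<longrightarrow> 0 \<in> lo x) \<and>
      (\<forall>j\<in>up x. let' x \<le> \<kappa> j \<and> (let' x = \<kappa> j \<longrightarrow> nxt j \<in> up y)) \<and>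
      (\<forall>j\<in>lo x. \<kappa>' j \<le> let' x \<and> (let' x = \<kappa>' j \<longrightarrow> nxt j \<in> lo y))" for x y
  define B where "B = enc ` ({0, 1} \<times> Pow {..<M + N} \<times> Pow {..<M + N})"
  have "finite B" by (simp add: B_def)
  define Y where "Y = {\<eta> \<in> full_shift B. \<forall>i. ok (\<eta> i) (\<eta> (Suc i))}"
  define \<pi> where "\<pi> \<eta> = (\<lambda>i. let' (\<eta> i))" for \<eta> :: "nat \<Rightarrow> nat"
  have sft: "subshift_of_finite_type B Y"
    unfolding Y_def by (rule subshift_of_finite_type_two_letter[OF \<open>finite B\<close>])
  have upto: "let' (\<eta> (i + l)) \<le> \<kappa> (j + l)"
    if "\<eta> \<in> Y" "j \<in> up (\<eta> i)" "\<forall>l'<l. let' (\<eta> (i + l')) = \<kappa> (j + l')" for \<eta> i j l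
    using that(2,3)
  proof (induction l arbitrary: i j)
    case 0
    then show ?case using \<open>\<eta> \<in> Y\<close> by (simp add: Y_def ok_def)
  next
    case (Suc l)
    have "let' (\<eta> i) = \<kappa> j" using Suc.prems(2)[rule_format, of 0] by simp
    then have "nxt j \<in> up (\<eta> (Suc i))" using Suc.prems \<open>\<eta> \<in> Y\<close> by (simp add: Y_def ok_def)
    moreover have "\<forall>l'<l. let' (\<eta> (Suc i + l')) = \<kappa> (nxt j + l')"
      using Suc.prems(2) by (metis add_Suc add_Suc_right Suc_less_eq tail(1))
    ultimately have "let' (\<eta> (Suc i + l)) \<le> \<kappa> (nxt j + l)" by (rule Suc.IH)
    then show ?case by (simp add: tail)
  qed
  have downto: "\<kappa>' (j + l) \<le> let' (\<eta> (i + l))"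
    if "\<eta> \<in> Y" "j \<in> lo (\<eta> i)" "\<forall>l'<l. let' (\<eta> (i + l')) = \<kappa>' (j + l')" for \<eta> i j l
    using that(2,3)
  proof (induction l arbitrary: i j)
    case 0
    then show ?case using \<open>\<eta> \<in> Y\<close> by (simp add: Y_def ok_def)
  next
    case (Suc l)
    have "let' (\<eta> i) = \<kappa>' j" using Suc.prems(2)[rule_format, of 0] by simp
    then have "nxt j \<in> lo (\<eta> (Suc i))" using Suc.prems \<open>\<eta> \<in> Y\<close> by (simp add: Y_def ok_def)
    moreover have "\<forall>l'<l. let' (\<eta> (Suc i + l')) = \<kappa>' (nxt j + l')"
      using Suc.prems(2) by (metis add_Suc add_Suc_right Suc_less_eq tail(2))
    ultimately have "\<kappa>' (nxt j + l) \<le> let' (\<eta> (Suc i + l))" by (rule Suc.IH)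
    then show ?case by (simp add: tail)
  qed
  have "\<pi> ` Y = admissible \<kappa> \<kappa>'"
  proof (intro equalityI subsetI)
    fix \<omega> assume "\<omega> \<in> \<pi> ` Y"
    then obtain \<eta> where \<eta>: "\<eta> \<in> Y" "\<omega> = \<pi> \<eta>" by auto
    have "\<omega> i \<in> {0, 1}" for i
    proof -
      have "\<eta> i \<in> B" using \<eta> by (auto simp: Y_def full_shift_def)
      then show ?thesis by (auto simp: B_def \<eta> \<pi>_def)
    qed
    moreover have "lex_le (\<lambda>j. \<omega> (i + j)) \<kappa>" if "\<omega> i = 0" for i
    proof -
      have "0 \<in> up (\<eta> i)" using that \<eta> by (auto simp: Y_def ok_def \<pi>_def)
      then show ?thesis using upto[OF \<eta>(1), of 0 i] by (auto simp: lex_le_def \<eta> \<pi>_def)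
    qed
    moreover have "lex_le \<kappa>' (\<lambda>j. \<omega> (i + j))" if "\<omega> i = 1" for i
    proof -
      have "0 \<in> lo (\<eta> i)" using that \<eta> by (auto simp: Y_def ok_def \<pi>_def)
      then show ?thesis using downto[OF \<eta>(1), of 0 i] by (auto simp: lex_le_def \<eta> \<pi>_def)
    qed
    ultimately show "\<omega> \<in> admissible \<kappa> \<kappa>'"
      by (auto simp: admissible_def full_shift_def image_subset_iff)
  next
    fix \<omega> assume \<omega>: "\<omega> \<in> admissible \<kappa> \<kappa>'"
    \<comment> \<open>The lift records all bounds that hold, not only those opened earlier; the
      transition condition then follows from the order alone.\<close>
    define A where "A i = {j. j < M + N \<and> lex_le (\<lambda>l. \<omega> (i + l)) (\<lambda>l. \<kappa> (j + l))}" for i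
    define C where "C i = {j. j < M + N \<and> lex_le (\<lambda>l. \<kappa>' (j + l)) (\<lambda>l. \<omega> (i + l))}" for i
    define \<eta> where "\<eta> i = enc (\<omega> i, A i, C i)" for i
    have fin: "finite (A i)" "finite (C i)" for i by (auto simp: A_def C_def)
    have "\<eta> i \<in> B" for i
      using admissible_in[OF \<omega>, of i] by (auto simp: B_def \<eta>_def A_def C_def)
    moreover have "ok (\<eta> i) (\<eta> (Suc i))" for i
    proof -
      have "\<omega> i = 0 \<longrightarrow> 0 \<in> A i" "\<omega> i = 1 \<longrightarrow> 0 \<in> C i"
        using \<omega> \<open>0 < N\<close> by (auto simp: A_def C_def admissible_def)
      moreover have "\<omega> i \<le> \<kappa> j \<and> (\<omega> i = \<kappa> j \<longrightarrow> nxt j \<in> A (Suc i))" if "j \<in> A i" for j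
        using that lex_le_head[of "\<lambda>l. \<omega> (i + l)" "\<lambda>l. \<kappa> (j + l)"]
          lex_le_tail[of "\<lambda>l. \<omega> (i + l)" "\<lambda>l. \<kappa> (j + l)"]
        by (auto simp: A_def nxt_less tail)
      moreover have "\<kappa>' j \<le> \<omega> i \<and> (\<omega> i = \<kappa>' j \<longrightarrow> nxt j \<in> C (Suc i))" if "j \<in> C i" for j
        using that lex_le_head[of "\<lambda>l. \<kappa>' (j + l)" "\<lambda>l. \<omega> (i + l)"]
          lex_le_tail[of "\<lambda>l. \<kappa>' (j + l)" "\<lambda>l. \<omega> (i + l)"]
        by (auto simp: C_def nxt_less tail)
      ultimately show ?thesis by (simp add: ok_def \<eta>_def fin)
    qed
    ultimately have "\<eta> \<in> Y" by (auto simp: Y_def full_shift_def)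
    moreover have "\<pi> \<eta> = \<omega>" by (simp add: \<pi>_def \<eta>_def)
    ultimately show "\<omega> \<in> \<pi> ` Y" by blast
  qed
  moreover have "continuous_on Y \<pi>"
    unfolding \<pi>_def
  proof (rule continuous_on_coordinatewise_then_product)
    fix i
    have "continuous_on Y (let' \<circ> (\<lambda>\<eta>. \<eta> i))"
      by (intro continuous_on_compose continuous_on_subset[OF continuous_on_product_coordinates]
          Topological_Spaces.continuous_on_discrete) auto
    then show "continuous_on Y (\<lambda>\<eta>. let' (\<eta> i))" by (simp add: o_def)
  qed
  moreover have "\<pi> (shift \<omega>) = shift (\<pi> \<omega>)" for \<omega>
    by (auto simp: \<pi>_def shift_def)
  ultimately show ?thesis
    using sft subshift_admissible unfolding sofic_def by blast
qed

section \<open>Lexicographic description of intermediate beta-shifts\<close>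

lemma expansion_minus_shift: "expansion_minus b \<alpha> x (i + j) = expansion_minus b \<alpha> ((T_minus b \<alpha> ^^ i) x) j"
  by (simp add: expansion_minus_def add.commute[of i j] funpow_add)

lemma expansion_plus_shift: "expansion_plus b \<alpha> x (i + j) = expansion_plus b \<alpha> ((T_plus b \<alpha> ^^ i) x) j"
  by (simp add: expansion_plus_def add.commute[of i j] funpow_add)

text \<open>Common weakening of the expansions for both maps: at the critical point either digit is
  allowed.\<close>

definition itinerary :: "real \<Rightarrow> real \<Rightarrow> (nat \<Rightarrow> nat) \<Rightarrow> (nat \<Rightarrow> real) \<Rightarrow> bool" where
  "itinerary b \<alpha> \<omega> X \<longleftrightarrow> (\<forall>i. \<omega> i \<in> {0, 1} \<and> X (Suc i) = b * X i + \<alpha> - real (\<omega> i) \<and>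
     (\<omega> i = 0 \<longrightarrow> X i \<le> crit b \<alpha>) \<and> (\<omega> i = 1 \<longrightarrow> crit b \<alpha> \<le> X i))"

lemma itinerary_minus: "itinerary b \<alpha> (expansion_minus b \<alpha> x) (\<lambda>i. (T_minus b \<alpha> ^^ i) x)"
  by (auto simp: itinerary_def expansion_minus_def T_minus_def)

lemma itinerary_plus: "itinerary b \<alpha> (expansion_plus b \<alpha> x) (\<lambda>i. (T_plus b \<alpha> ^^ i) x)"
  by (auto simp: itinerary_def expansion_plus_def T_plus_def)

lemma orbit_difference:
  fixes X Y :: "nat \<Rightarrow> real"
  assumes "\<And>i. X (Suc i) = b * X i + \<alpha> - real (\<omega> i)" "\<And>i. Y (Suc i) = b * Y i + \<alpha> - real (\<eta> i)"
    and "\<forall>i<j. \<omega> i = \<eta> i"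
  shows "X j - Y j = b ^ j * (X 0 - Y 0)"
  using assms(3)
proof (induction j)
  case (Suc j)
  have "X (Suc j) - Y (Suc j) = b * (X j - Y j)"
    using Suc.prems by (simp add: assms(1,2) algebra_simps)
  then show ?case using Suc by simp
qed simp

text \<open>While the digits agree, the distance of the points is multiplied by \<open>b\<close>. At
  the first disagreement the points are therefore still strictly ordered, and digits in the opposite
  order would put them on the wrong sides of the critical point.\<close>

lemma itinerary_lex_le:
  assumes "0 < b" "itinerary b \<alpha> \<omega> X" "itinerary b \<alpha> \<eta> Y" "X 0 < Y 0"
  shows "lex_le \<omega> \<eta>"
  unfolding lex_le_def
proof (intro allI impI)
  fix j assume "\<forall>i<j. \<omega> i = \<eta> i"
  then have "X j - Y j = b ^ j * (X 0 - Y 0)"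
    using assms(2,3) by (intro orbit_difference[where \<alpha> = \<alpha> and \<omega> = \<omega> and \<eta> = \<eta>]) (auto simp: itinerary_def)
  also have "\<dots> < 0" using assms by (simp add: mult_pos_neg)
  finally have "X j < Y j" by simp
  moreover have "\<omega> j \<in> {0, 1}" "\<eta> j \<in> {0, 1}" "\<omega> j = 1 \<longrightarrow> crit b \<alpha> \<le> X j" "\<eta> j = 0 \<longrightarrow> Y j \<le> crit b \<alpha>"
    using assms(2,3) unfolding itinerary_def by blast+
  ultimately show "\<omega> j \<le> \<eta> j" by auto
qed

lemma bounded_orbit_unique:
  fixes X Y :: "nat \<Rightarrow> real"
  assumes "1 < b" "\<And>i. X (Suc i) = b * X i + \<alpha> - real (\<omega> i)" "\<And>i. Y (Suc i) = b * Y i + \<alpha> - real (\<omega> i)"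
    and bound: "\<And>i. \<bar>X i\<bar> \<le> C" "\<And>i. \<bar>Y i\<bar> \<le> C"
  shows "X 0 = Y 0"
proof (rule ccontr)
  assume "X 0 \<noteq> Y 0"
  obtain j where "2 * C / \<bar>X 0 - Y 0\<bar> < b ^ j"
    using real_arch_pow[OF \<open>1 < b\<close>] by blast
  then have "2 * C < b ^ j * \<bar>X 0 - Y 0\<bar>" using \<open>X 0 \<noteq> Y 0\<close> by (simp add: field_simps)
  also have "\<dots> = \<bar>X j - Y j\<bar>"
    using orbit_difference[of X b \<alpha> \<omega> Y \<omega> j] assms by (simp add: abs_mult)
  also have "\<dots> \<le> 2 * C" using bound[of j] by simp
  finally show False by simp
qed

lemma expansion_minus_unique:
  assumes "\<And>i. \<omega> i \<in> {0, 1}" "\<And>i. X (Suc i) = b * X i + \<alpha> - real (\<omega> i)"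
    and "\<And>i. \<omega> i = 0 \<longleftrightarrow> X i \<le> crit b \<alpha>"
  shows "\<omega> = expansion_minus b \<alpha> (X 0)"
proof -
  have "(T_minus b \<alpha> ^^ i) (X 0) = X i" for i
  proof (induction i)
    case (Suc i)
    then show ?case using assms(1)[of i] assms(2,3)[of i] by (auto simp: T_minus_def)
  qed simp
  then show ?thesis using assms(1,3) by (auto simp: expansion_minus_def fun_eq_iff)
qed

lemma expansion_plus_unique:
  assumes "\<And>i. \<omega> i \<in> {0, 1}" "\<And>i. X (Suc i) = b * X i + \<alpha> - real (\<omega> i)"
    and "\<And>i. \<omega> i = 0 \<longleftrightarrow> X i < crit b \<alpha>"
  shows "\<omega> = expansion_plus b \<alpha> (X 0)"
proof -
  have "(T_plus b \<alpha> ^^ i) (X 0) = X i" for i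
  proof (induction i)
    case (Suc i)
    then show ?case using assms(1)[of i] assms(2,3)[of i] by (auto simp: T_plus_def)
  qed simp
  then show ?thesis using assms(1,3) by (auto simp: expansion_plus_def fun_eq_iff)
qed

lemma crit_mem_J:
  assumes "1 < b" "0 \<le> \<alpha>" "\<alpha> \<le> 2 - b"
  shows "crit b \<alpha> \<in> J b \<alpha>"
proof -
  have "- \<alpha> / (b - 1) \<le> 0" "0 \<le> crit b \<alpha>" using assms by (auto simp: crit_def field_simps)
  moreover have "crit b \<alpha> \<le> (1 - \<alpha>) / (b - 1)"
    unfolding crit_def using assms by (intro divide_left_mono) auto
  ultimately show ?thesis by (simp add: J_def)
qed

lemma T_mem_J:
  assumes "1 < b" "0 \<le> \<alpha>" "\<alpha> \<le> 2 - b" "x \<in> J b \<alpha>"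
  shows "T_minus b \<alpha> x \<in> J b \<alpha>" "T_plus b \<alpha> x \<in> J b \<alpha>"
proof -
  have x: "- \<alpha> \<le> (b - 1) * x" "(b - 1) * x \<le> 1 - \<alpha>"
    using assms by (auto simp: J_def field_simps)
  have J: "y \<in> J b \<alpha>" if "- \<alpha> \<le> (b - 1) * y" "(b - 1) * y \<le> 1 - \<alpha>" for y
    using assms(1) that by (auto simp: J_def field_simps)
  have "b * x + \<alpha> \<in> J b \<alpha>" if "x \<le> crit b \<alpha>"
  proof (rule J)
    have "b * (- \<alpha>) \<le> b * ((b - 1) * x)" using x assms by (intro mult_left_mono) auto
    then show "- \<alpha> \<le> (b - 1) * (b * x + \<alpha>)" by (simp add: algebra_simps)
    have "b * x + \<alpha> \<le> 1" using that assms by (simp add: crit_def field_simps)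
    then have "(b - 1) * (b * x + \<alpha>) \<le> (b - 1) * 1" using assms by (intro mult_left_mono) auto
    also have "\<dots> \<le> 1 - \<alpha>" using assms by simp
    finally show "(b - 1) * (b * x + \<alpha>) \<le> 1 - \<alpha>" .
  qed
  moreover have "b * x + \<alpha> - 1 \<in> J b \<alpha>" if "crit b \<alpha> \<le> x"
  proof (rule J)
    have "b * ((b - 1) * x) \<le> b * (1 - \<alpha>)" using x assms by (intro mult_left_mono) auto
    then show "(b - 1) * (b * x + \<alpha> - 1) \<le> 1 - \<alpha>" by (simp add: algebra_simps)
    have "0 \<le> b * x + \<alpha> - 1" using that assms by (simp add: crit_def field_simps)
    then have "0 \<le> (b - 1) * (b * x + \<alpha> - 1)" using assms by (intro mult_nonneg_nonneg) auto
    moreover have "- \<alpha> \<le> 0" using assms by simp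
    ultimately show "- \<alpha> \<le> (b - 1) * (b * x + \<alpha> - 1)" by (rule order_trans[rotated])
  qed
  ultimately show "T_minus b \<alpha> x \<in> J b \<alpha>" "T_plus b \<alpha> x \<in> J b \<alpha>"
    by (auto simp: T_minus_def T_plus_def)
qed

lemma T_funpow_mem_J:
  assumes "1 < b" "0 \<le> \<alpha>" "\<alpha> \<le> 2 - b" "x \<in> J b \<alpha>"
  shows "(T_minus b \<alpha> ^^ i) x \<in> J b \<alpha>" "(T_plus b \<alpha> ^^ i) x \<in> J b \<alpha>"
  by (induction i) (auto simp: assms T_mem_J[OF assms(1-3)])

lemma J_abs_le: "x \<in> J b \<alpha> \<Longrightarrow> \<bar>x\<bar> \<le> \<bar>\<alpha> / (b - 1)\<bar> + \<bar>(1 - \<alpha>) / (b - 1)\<bar>"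
  by (auto simp: J_def simp del: abs_divide)

text \<open>The only point whose orbit can have the digits \<open>\<omega>\<close>.\<close>

definition digit_value :: "real \<Rightarrow> real \<Rightarrow> (nat \<Rightarrow> nat) \<Rightarrow> real" where
  "digit_value b \<alpha> \<omega> = (\<Sum>j. (real (\<omega> j) - \<alpha>) * (1 / b) ^ Suc j)"

lemma digit_value:
  assumes "1 < b" "\<And>i. \<omega> i \<in> {0, 1}"
  shows "digit_value b \<alpha> \<omega> \<in> J b \<alpha>"
    and "digit_value b \<alpha> (\<lambda>j. \<omega> (Suc j)) = b * digit_value b \<alpha> \<omega> + \<alpha> - real (\<omega> 0)"
proof -
  define t where "t j = (real (\<omega> j) - \<alpha>) * (1 / b) ^ Suc j" for j
  have geo: "(\<lambda>j. c * (1 / b) ^ Suc j) sums (c / (b - 1))" for c :: real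
  proof -
    have "(\<lambda>j. c / b * (1 / b) ^ j) sums (c / b * (1 / (1 - 1 / b)))"
      using assms by (intro sums_mult geometric_sums) auto
    moreover have "c / b * (1 / (1 - 1 / b)) = c / (b - 1)" using assms by (simp add: field_simps)
    moreover have "(\<lambda>j. c / b * (1 / b) ^ j) = (\<lambda>j. c * (1 / b) ^ Suc j)" by simp
    ultimately show ?thesis by (simp only:)
  qed
  have le: "(- \<alpha>) * (1 / b) ^ Suc j \<le> t j" "t j \<le> (1 - \<alpha>) * (1 / b) ^ Suc j" for j
    unfolding t_def using assms(1) assms(2)[of j] by (intro mult_right_mono; auto)+
  have "summable t"
  proof (rule summable_comparison_test')
    show "norm (t j) \<le> (1 + \<bar>\<alpha>\<bar>) * (1 / b) ^ Suc j" if "0 \<le> j" for j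
      unfolding t_def norm_mult using assms(1) assms(2)[of j] by (intro mult_mono) auto
    show "summable (\<lambda>j. (1 + \<bar>\<alpha>\<bar>) * (1 / b) ^ Suc j)" using geo sums_summable by blast
  qed
  have "- \<alpha> / (b - 1) \<le> suminf t"
    by (rule sums_le[OF le(1) geo summable_sums[OF \<open>summable t\<close>]])
  moreover have "suminf t \<le> (1 - \<alpha>) / (b - 1)"
    by (rule sums_le[OF le(2) summable_sums[OF \<open>summable t\<close>] geo])
  ultimately show "digit_value b \<alpha> \<omega> \<in> J b \<alpha>" unfolding digit_value_def J_def t_def by simp
  have "suminf t = t 0 + (\<Sum>j. t (Suc j))"
    using suminf_split_head[OF \<open>summable t\<close>] by simp
  also have "(\<Sum>j. t (Suc j)) = (\<Sum>j. 1 / b * ((real (\<omega> (Suc j)) - \<alpha>) * (1 / b) ^ Suc j))"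
    by (simp add: t_def mult_ac)
  also have "\<dots> = 1 / b * digit_value b \<alpha> (\<lambda>j. \<omega> (Suc j))"
    unfolding digit_value_def
  proof (rule suminf_mult)
    have "(\<lambda>j. t (Suc j)) = (\<lambda>j. 1 / b * ((real (\<omega> (Suc j)) - \<alpha>) * (1 / b) ^ Suc j))"
      by (simp add: t_def mult_ac)
    moreover have "summable (\<lambda>j. t (Suc j))" using \<open>summable t\<close> by (simp only: summable_Suc_iff)
    ultimately show "summable (\<lambda>j. (real (\<omega> (Suc j)) - \<alpha>) * (1 / b) ^ Suc j)"
      using assms(1) summable_cmult_iff[of "1 / b"] by force
  qed
  finally have "suminf t = t 0 + 1 / b * digit_value b \<alpha> (\<lambda>j. \<omega> (Suc j))" .
  moreover have "suminf t = digit_value b \<alpha> \<omega>" unfolding digit_value_def t_def ..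
  moreover have "t 0 = (real (\<omega> 0) - \<alpha>) / b" by (simp add: t_def)
  ultimately have "b * digit_value b \<alpha> \<omega> =
      b * ((real (\<omega> 0) - \<alpha>) / b + 1 / b * digit_value b \<alpha> (\<lambda>j. \<omega> (Suc j)))"
    by simp
  also have "\<dots> = real (\<omega> 0) - \<alpha> + digit_value b \<alpha> (\<lambda>j. \<omega> (Suc j))"
    using assms(1) by (simp add: distrib_left)
  finally show "digit_value b \<alpha> (\<lambda>j. \<omega> (Suc j)) = b * digit_value b \<alpha> \<omega> + \<alpha> - real (\<omega> 0)"
    by simp
qed

text \<open>A positive value would start a chain of indices along which the values grow by a factor
  of at least \<open>b\<close> each time, beyond \<open>C\<close>. The index type is left open so
  that the principle applies to tails of a word and to pairs of neighbouring blocks alike.\<close>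

lemma expanding_bounded_nonpos:
  fixes v :: "'i \<Rightarrow> real"
  assumes "1 < b" and bound: "\<And>i. P i \<Longrightarrow> v i \<le> C"
    and step: "\<And>i. P i \<Longrightarrow> 0 < v i \<Longrightarrow> \<exists>i'. P i' \<and> b * v i \<le> v i'"
    and "P i"
  shows "v i \<le> 0"
proof (rule ccontr)
  assume "\<not> v i \<le> 0"
  have "\<exists>i'. P i' \<and> b ^ n * v i \<le> v i'" for n
  proof (induction n)
    case (Suc n)
    then obtain i' where i': "P i'" "b ^ n * v i \<le> v i'" by blast
    moreover have "0 < b ^ n * v i" using \<open>1 < b\<close> \<open>\<not> v i \<le> 0\<close> by simp
    ultimately obtain i'' where "P i''" "b * v i' \<le> v i''" using step[of i'] by auto
    moreover have "b * (b ^ n * v i) \<le> b * v i'" using i' \<open>1 < b\<close> by (intro mult_left_mono) auto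
    ultimately show ?case by (auto simp: mult.assoc intro!: exI[of _ i''])
  qed (use \<open>P i\<close> in auto)
  moreover obtain n where "C / v i < b ^ n" using real_arch_pow[OF \<open>1 < b\<close>] by blast
  then have "C < b ^ n * v i" using \<open>\<not> v i \<le> 0\<close> by (simp add: field_simps)
  ultimately show False using bound by (meson le_less_trans not_less)
qed

text \<open>Expansions are monotone in the point, which makes them admissible. Conversely, the
  constraints force the point \<open>v i\<close> coded by the tail at \<open>i\<close> to lie on the
  side of the critical point that its digit prescribes. Ambiguity remains only at the critical point
  itself: the digit at the first visit decides whether the word is an expansion for the lower or for
  the upper map.\<close>

theorem \<Omega>_eq_admissible:
  assumes b: "1 < b" and \<alpha>: "0 \<le> \<alpha>" "\<alpha> \<le> 2 - b"
  shows "\<Omega> b \<alpha> = admissible (expansion_minus b \<alpha> (crit b \<alpha>)) (expansion_plus b \<alpha> (crit b \<alpha>))"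
    (is "_ = admissible ?\<kappa> ?\<kappa>'")
proof (intro equalityI subsetI)
  let ?p = "crit b \<alpha>"
  fix \<omega> assume "\<omega> \<in> \<Omega> b \<alpha>"
  then consider x where "\<omega> = expansion_minus b \<alpha> x" | x where "\<omega> = expansion_plus b \<alpha> x"
    by (auto simp: \<Omega>_def)
  then show "\<omega> \<in> admissible ?\<kappa> ?\<kappa>'"
  proof cases
    case (1 x)
    define X where "X i = (T_minus b \<alpha> ^^ i) x" for i
    have sh: "(\<lambda>j. \<omega> (i + j)) = expansion_minus b \<alpha> (X i)" for i
      using 1 by (simp add: expansion_minus_shift X_def)
    have "lex_le (\<lambda>j. \<omega> (i + j)) ?\<kappa>" if "\<omega> i = 0" for i
    proof -
      have "X i \<le> ?p" using that 1 by (auto simp: expansion_minus_def X_def split: if_splits)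
      then consider "X i = ?p" | "X i < ?p" by linarith
      then show ?thesis
      proof cases
        case 2
        then show ?thesis unfolding sh
          using b by (intro itinerary_lex_le[OF _ itinerary_minus itinerary_minus]) auto
      qed (simp add: sh)
    qed
    moreover have "lex_le ?\<kappa>' (\<lambda>j. \<omega> (i + j))" if "\<omega> i = 1" for i
    proof -
      have "?p < X i" using that 1 by (auto simp: expansion_minus_def X_def split: if_splits)
      then show ?thesis unfolding sh
        using b by (intro itinerary_lex_le[OF _ itinerary_plus itinerary_minus]) auto
    qed
    ultimately show ?thesis
      by (auto simp: admissible_def full_shift_def 1 expansion_minus_def)
  next
    case (2 x)
    define X where "X i = (T_plus b \<alpha> ^^ i) x" for i
    have sh: "(\<lambda>j. \<omega> (i + j)) = expansion_plus b \<alpha> (X i)" for i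
      using 2 by (simp add: expansion_plus_shift X_def)
    have "lex_le ?\<kappa>' (\<lambda>j. \<omega> (i + j))" if "\<omega> i = 1" for i
    proof -
      have "?p \<le> X i" using that 2 by (auto simp: expansion_plus_def X_def split: if_splits)
      then consider "X i = ?p" | "?p < X i" by linarith
      then show ?thesis
      proof cases
        case 2
        then show ?thesis unfolding sh
          using b by (intro itinerary_lex_le[OF _ itinerary_plus itinerary_plus]) auto
      qed (simp add: sh)
    qed
    moreover have "lex_le (\<lambda>j. \<omega> (i + j)) ?\<kappa>" if "\<omega> i = 0" for i
    proof -
      have "X i < ?p" using that 2 by (auto simp: expansion_plus_def X_def split: if_splits)
      then show ?thesis unfolding sh
        using b by (intro itinerary_lex_le[OF _ itinerary_plus itinerary_minus]) auto
    qed
    ultimately show ?thesis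
      by (auto simp: admissible_def full_shift_def 2 expansion_plus_def)
  qed
next
  let ?p = "crit b \<alpha>"
  fix \<omega> assume \<omega>: "\<omega> \<in> admissible ?\<kappa> ?\<kappa>'"
  have bin: "\<omega> i \<in> {0, 1}" for i using admissible_in[OF \<omega>] .
  have lex: "lex_le (\<lambda>j. \<omega> (i + j)) ?\<kappa>" if "\<omega> i = 0" for i
    using \<omega> that by (simp add: admissible_def)
  have lex': "lex_le ?\<kappa>' (\<lambda>j. \<omega> (i + j))" if "\<omega> i = 1" for i
    using \<omega> that by (simp add: admissible_def)
  define v where "v i = digit_value b \<alpha> (\<lambda>j. \<omega> (i + j))" for i
  have vJ: "v i \<in> J b \<alpha>" for i
    unfolding v_def using b bin by (rule digit_value)
  have rec: "v (Suc i) = b * v i + \<alpha> - real (\<omega> i)" for i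
    using digit_value(2)[of b "\<lambda>j. \<omega> (i + j)"] b bin by (simp add: v_def)
  define C where "C = \<bar>\<alpha> / (b - 1)\<bar> + \<bar>(1 - \<alpha>) / (b - 1)\<bar>"
  have vC: "\<bar>v i\<bar> \<le> C" for i unfolding C_def by (rule J_abs_le[OF vJ])
  define K where "K j = (T_minus b \<alpha> ^^ j) ?p" for j
  define K' where "K' j = (T_plus b \<alpha> ^^ j) ?p" for j
  have K: "itinerary b \<alpha> ?\<kappa> K" unfolding K_def by (rule itinerary_minus)
  have K': "itinerary b \<alpha> ?\<kappa>' K'" unfolding K'_def by (rule itinerary_plus)
  have KC: "\<bar>K i\<bar> \<le> C" "\<bar>K' i\<bar> \<le> C" for i
    unfolding C_def K_def K'_def using b \<alpha> by (intro J_abs_le T_funpow_mem_J crit_mem_J; simp)+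
  have K0: "K 0 = ?p" "K' 0 = ?p" by (auto simp: K_def K'_def)
  have Krec: "K (Suc i) = b * K i + \<alpha> - real (?\<kappa> i)" "K' (Suc i) = b * K' i + \<alpha> - real (?\<kappa>' i)" for i
    using K K' by (auto simp: itinerary_def)
  have diff: "v (i + j) - K j = b ^ j * (v i - ?p)" if "\<forall>l<j. \<omega> (i + l) = ?\<kappa> l" for i j
    using orbit_difference[of "\<lambda>l. v (i + l)" b \<alpha> "\<lambda>l. \<omega> (i + l)" K ?\<kappa> j] that rec Krec K0 by simp
  have diff': "v (i + j) - K' j = b ^ j * (v i - ?p)" if "\<forall>l<j. \<omega> (i + l) = ?\<kappa>' l" for i j
    using orbit_difference[of "\<lambda>l. v (i + l)" b \<alpha> "\<lambda>l. \<omega> (i + l)" K' ?\<kappa>' j] that rec Krec K0 by simp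
  have \<kappa>01: "?\<kappa> j \<in> {0, 1}" "?\<kappa>' j \<in> {0, 1}" for j
    by (auto simp: expansion_minus_def expansion_plus_def)
  have below: "v i \<le> ?p" if "\<omega> i = 0" for i
  proof -
    have "v i - ?p \<le> 0"
    proof (rule expanding_bounded_nonpos[of b "\<lambda>i. \<omega> i = 0" "\<lambda>i. v i - ?p" "C + C"])
      show "v i - ?p \<le> C + C" for i using vC[of i] KC[of 0] K0 by (auto simp: abs_le_iff)
      fix i assume i: "\<omega> i = 0" "0 < v i - ?p"
      have "(\<lambda>j. \<omega> (i + j)) \<noteq> ?\<kappa>"
      proof
        assume eq: "(\<lambda>j. \<omega> (i + j)) = ?\<kappa>"
        have "v (i + 0) = K 0"
          by (rule bounded_orbit_unique[of b "\<lambda>l. v (i + l)" \<alpha> ?\<kappa> K C])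
            (use b rec Krec vC KC in \<open>simp_all add: eq[symmetric]\<close>)
        then show False using i K0 by simp
      qed
      with lex[OF i(1)] obtain j where j: "\<forall>l<j. \<omega> (i + l) = ?\<kappa> l" "\<omega> (i + j) < ?\<kappa> j"
        by (rule lex_le_neq_D)
      \<comment> \<open>Both words begin with 0, so the disagreement comes later and the factor
        \<open>b ^ j\<close> is at least \<open>b\<close>. There \<open>\<kappa>\<close> has digit
        1, so \<open>K j\<close> is not left of \<open>?p\<close> and the excess of
        \<open>v (i + j)\<close> over \<open>?p\<close> is at least its excess over
        \<open>K j\<close>.\<close>
      have "?\<kappa> 0 = 0" by (simp add: expansion_minus_def)
      then have "0 < j" using j(2) by (cases j) auto
      have \<kappa>j: "?\<kappa> j = 1" "\<omega> (i + j) = 0" using j(2) \<kappa>01(1)[of j] by auto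
      then have "?p \<le> K j" using K by (auto simp: itinerary_def)
      then have "b ^ j * (v i - ?p) \<le> v (i + j) - ?p" using diff[OF j(1)] by simp
      moreover have "b ^ 1 * (v i - ?p) \<le> b ^ j * (v i - ?p)"
        using i \<open>0 < j\<close> b by (intro mult_right_mono power_increasing) auto
      ultimately show "\<exists>i'. \<omega> i' = 0 \<and> b * (v i - ?p) \<le> v i' - ?p"
        using \<kappa>j by (intro exI[of _ "i + j"]) auto
    qed (use b that in auto)
    then show ?thesis by simp
  qed
  have above: "?p \<le> v i" if "\<omega> i = 1" for i
  proof -
    have "?p - v i \<le> 0"
    proof (rule expanding_bounded_nonpos[of b "\<lambda>i. \<omega> i = 1" "\<lambda>i. ?p - v i" "C + C"])
      show "?p - v i \<le> C + C" for i using vC[of i] KC[of 0] K0 by (auto simp: abs_le_iff)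
      fix i assume i: "\<omega> i = 1" "0 < ?p - v i"
      have "?\<kappa>' \<noteq> (\<lambda>j. \<omega> (i + j))"
      proof
        assume eq: "?\<kappa>' = (\<lambda>j. \<omega> (i + j))"
        have "v (i + 0) = K' 0"
          by (rule bounded_orbit_unique[of b "\<lambda>l. v (i + l)" \<alpha> ?\<kappa>' K' C])
            (use b rec Krec vC KC in \<open>simp_all add: eq\<close>)
        then show False using i K0 by simp
      qed
      with lex'[OF i(1)] obtain j where j: "\<forall>l<j. ?\<kappa>' l = \<omega> (i + l)" "?\<kappa>' j < \<omega> (i + j)"
        by (rule lex_le_neq_D)
      have "?\<kappa>' 0 = 1" by (simp add: expansion_plus_def)
      then have "0 < j" using j(2) bin[of i] by (cases j) auto
      have \<kappa>j: "?\<kappa>' j = 0" "\<omega> (i + j) = 1" using j(2) bin[of "i + j"] by auto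
      then have "K' j \<le> ?p" using K' by (auto simp: itinerary_def)
      then have "b ^ j * (?p - v i) \<le> ?p - v (i + j)" using diff'[of j i] j(1) by (simp add: algebra_simps)
      moreover have "b ^ 1 * (?p - v i) \<le> b ^ j * (?p - v i)"
        using i \<open>0 < j\<close> b by (intro mult_right_mono power_increasing) auto
      ultimately show "\<exists>i'. \<omega> i' = 1 \<and> b * (?p - v i) \<le> ?p - v i'"
        using \<kappa>j by (intro exI[of _ "i + j"]) auto
    qed (use b that in auto)
    then show ?thesis by simp
  qed
  have off: "\<omega> i = 0 \<longleftrightarrow> v i < ?p" if "v i \<noteq> ?p" for i
    using bin[of i] below[of i] above[of i] that by auto
  have v0: "v 0 \<in> J b \<alpha>" by (rule vJ)
  show "\<omega> \<in> \<Omega> b \<alpha>"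
  proof (cases "\<exists>i. v i = ?p")
    case False
    then have "\<omega> = expansion_plus b \<alpha> (v 0)" using off by (intro expansion_plus_unique bin rec) auto
    then show ?thesis using v0 by (auto simp: \<Omega>_def)
  next
    case True
    \<comment> \<open>Before the first visit both maps act alike; from then on the digits are forced
      to be those of a critical orbit.\<close>
    define i where "i = (LEAST i. v i = ?p)"
    have vi: "v i = ?p" unfolding i_def using True by (rule LeastI_ex)
    have before: "v l \<noteq> ?p" if "l < i" for l using that not_less_Least i_def by blast
    have "\<omega> i \<in> {0, 1}" by (rule bin)
    then consider "\<omega> i = 0" | "\<omega> i = 1" by auto
    then show ?thesis
    proof cases
      case 1
      have eq: "(\<lambda>j. \<omega> (i + j)) = ?\<kappa>"
      proof (rule ccontr)
        assume "(\<lambda>j. \<omega> (i + j)) \<noteq> ?\<kappa>"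
        with lex[OF 1] obtain j where j: "\<forall>l<j. \<omega> (i + l) = ?\<kappa> l" "\<omega> (i + j) < ?\<kappa> j"
          by (rule lex_le_neq_D)
        \<comment> \<open>For the lower map digit 1 means strictly right of \<open>?p\<close>,
          whereas \<open>v (i + j)\<close> equals \<open>K j\<close> and carries digit 0.\<close>
        have "?\<kappa> j = 1" "\<omega> (i + j) = 0" using j(2) \<kappa>01(1)[of j] by auto
        then have "v (i + j) \<le> ?p" "?p < K j" using below
          by (auto simp: expansion_minus_def K_def split: if_splits)
        then show False using diff[OF j(1)] vi by simp
      qed
      have "\<omega> l = 0 \<longleftrightarrow> v l \<le> ?p" for l
      proof (cases "l < i")
        case True
        then show ?thesis using off[OF before] before by force
      next
        case False
        then obtain j where l: "l = i + j" using le_Suc_ex not_less by blast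
        have "\<forall>l<j. \<omega> (i + l) = ?\<kappa> l" using eq by (simp add: fun_eq_iff)
        then have "v l = K j" using diff[of j i] vi l by simp
        moreover have "\<omega> l = ?\<kappa> j" using eq l by (simp add: fun_eq_iff)
        ultimately show ?thesis by (simp add: expansion_minus_def K_def)
      qed
      then have "\<omega> = expansion_minus b \<alpha> (v 0)" by (intro expansion_minus_unique bin rec) auto
      then show ?thesis using v0 by (auto simp: \<Omega>_def)
    next
      case 2
      have eq: "?\<kappa>' = (\<lambda>j. \<omega> (i + j))"
      proof (rule ccontr)
        assume "?\<kappa>' \<noteq> (\<lambda>j. \<omega> (i + j))"
        with lex'[OF 2] obtain j where j: "\<forall>l<j. ?\<kappa>' l = \<omega> (i + l)" "?\<kappa>' j < \<omega> (i + j)"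
          by (rule lex_le_neq_D)
        have "?\<kappa>' j = 0" "\<omega> (i + j) = 1" using j(2) bin[of "i + j"] by auto
        then have "?p \<le> v (i + j)" "K' j < ?p" using above
          by (auto simp: expansion_plus_def K'_def split: if_splits)
        then show False using diff'[of j i] j(1) vi by simp
      qed
      have "\<omega> l = 0 \<longleftrightarrow> v l < ?p" for l
      proof (cases "l < i")
        case True
        then show ?thesis using off[OF before] by force
      next
        case False
        then obtain j where l: "l = i + j" using le_Suc_ex not_less by blast
        have "\<forall>l<j. \<omega> (i + l) = ?\<kappa>' l" using eq by (simp add: fun_eq_iff)
        then have "v l = K' j" using diff'[of j i] vi l by simp
        moreover have "\<omega> l = ?\<kappa>' j" using eq l by (simp add: fun_eq_iff)
        ultimately show ?thesis by (simp add: expansion_plus_def K'_def)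
      qed
      then have "\<omega> = expansion_plus b \<alpha> (v 0)" by (intro expansion_plus_unique bin rec) auto
      then show ?thesis using v0 by (auto simp: \<Omega>_def)
    qed
  qed
qed

lemma \<Omega>_finite_type:
  assumes "1 < b" "0 \<le> \<alpha>" "\<alpha> \<le> 2 - b" "0 < N"
    and "(T_minus b \<alpha> ^^ N) (crit b \<alpha>) = crit b \<alpha>" "(T_plus b \<alpha> ^^ N) (crit b \<alpha>) = crit b \<alpha>"
  shows "subshift_of_finite_type {0, 1} (\<Omega> b \<alpha>)"
  unfolding \<Omega>_eq_admissible[OF assms(1-3)]
proof (rule subshift_of_finite_type_admissible[OF \<open>0 < N\<close>])
  show "expansion_minus b \<alpha> (crit b \<alpha>) (i + N) = expansion_minus b \<alpha> (crit b \<alpha>) i" for i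
    unfolding add.commute[of i N] expansion_minus_shift assms(5) ..
  show "expansion_plus b \<alpha> (crit b \<alpha>) (i + N) = expansion_plus b \<alpha> (crit b \<alpha>) i" for i
    unfolding add.commute[of i N] expansion_plus_shift assms(6) ..
qed (auto simp: expansion_minus_def expansion_plus_def)

lemma funpow_eventually_periodic:
  fixes f :: "'a \<Rightarrow> 'a"
  assumes "(f ^^ i) x = (f ^^ j) x" "i < j" "i \<le> l"
  shows "(f ^^ (l + c * (j - i))) x = (f ^^ l) x"
proof (induction c)
  case (Suc c)
  have step: "(f ^^ (m + j)) x = (f ^^ (m + i)) x" for m
    using assms(1) by (simp add: funpow_add)
  obtain d where d: "l = i + d" using assms(3) le_Suc_ex by blast
  obtain e where e: "j = i + e" using assms(2) less_imp_le le_Suc_ex by blast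
  have "(f ^^ (l + Suc c * (j - i))) x = (f ^^ (l - i + c * (j - i) + j)) x"
    using assms by (intro arg_cong[where f = "\<lambda>m. (f ^^ m) x"]) (simp add: d e)
  also have "\<dots> = (f ^^ (l - i + c * (j - i) + i)) x"
    by (rule step)
  also have "\<dots> = (f ^^ (l + c * (j - i))) x" by (simp add: d e add_ac)
  finally show ?case using Suc by simp
qed simp

lemma \<Omega>_sofic:
  assumes "1 < b" "0 \<le> \<alpha>" "\<alpha> \<le> 2 - b"
    and minus: "(T_minus b \<alpha> ^^ i) (crit b \<alpha>) = (T_minus b \<alpha> ^^ j) (crit b \<alpha>)" "i < j"
    and plus: "(T_plus b \<alpha> ^^ i') (crit b \<alpha>) = (T_plus b \<alpha> ^^ j') (crit b \<alpha>)" "i' < j'"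
  shows "sofic {0, 1} (\<Omega> b \<alpha>)"
  unfolding \<Omega>_eq_admissible[OF assms(1-3)]
\<comment> \<open>One preperiod and one period have to serve both expansions: the maximum and the
  product.\<close>
proof (rule sofic_admissible[where M = "max i i'" and N = "(j - i) * (j' - i')"])
  show "0 < (j - i) * (j' - i')" using assms by simp
  fix l assume l: "max i i' \<le> l"
  then have "(T_minus b \<alpha> ^^ (l + (j' - i') * (j - i))) (crit b \<alpha>) = (T_minus b \<alpha> ^^ l) (crit b \<alpha>)"
    by (intro funpow_eventually_periodic minus) auto
  then show "expansion_minus b \<alpha> (crit b \<alpha>) (l + (j - i) * (j' - i')) = expansion_minus b \<alpha> (crit b \<alpha>) l"
    by (simp add: expansion_minus_def mult.commute)
  from l have "(T_plus b \<alpha> ^^ (l + (j - i) * (j' - i'))) (crit b \<alpha>) = (T_plus b \<alpha> ^^ l) (crit b \<alpha>)"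
    by (intro funpow_eventually_periodic plus) auto
  then show "expansion_plus b \<alpha> (crit b \<alpha>) (l + (j - i) * (j' - i')) = expansion_plus b \<alpha> (crit b \<alpha>) l"
    by (simp add: expansion_plus_def)
qed

section \<open>Renormalisation\<close>

text \<open>The digits \<open>\<lfloor>(i + 1) k / n\<rfloor> - \<lfloor>i k / n\<rfloor>\<close> of the rotation by \<open>k / n\<close>.\<close>

definition rot_digit :: "nat \<Rightarrow> nat \<Rightarrow> nat \<Rightarrow> nat" where
  "rot_digit n k i = (if n \<le> i * k mod n + k then 1 else 0)"

fun lo :: "nat \<Rightarrow> nat \<Rightarrow> real \<Rightarrow> real \<Rightarrow> nat \<Rightarrow> real" where
  "lo n k b \<alpha> 0 = 0"
| "lo n k b \<alpha> (Suc j) = b * lo n k b \<alpha> j + \<alpha> - real (rot_digit n k j)"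

text \<open>\<open>lo\<close> is the orbit of 0 and, for \<open>0 < j\<close>, \<open>hi\<close> is
  the orbit of 1, as long as the digits follow the rotation. The initial value
  \<open>1 - 1 / b\<close> stands in for 1: the branch with digit 0 sends it where the branch with
  digit 1 sends 1.\<close>

definition hi :: "nat \<Rightarrow> nat \<Rightarrow> real \<Rightarrow> real \<Rightarrow> nat \<Rightarrow> real" where
  "hi n k b \<alpha> j = lo n k b \<alpha> j + b ^ j * (1 - 1 / b)"

text \<open>The residue \<open>n - k\<close> is the threshold at which \<open>rot_digit\<close>
  jumps to 1. Hence index \<open>n - 1\<close> belongs to the block around the critical
  point.\<close>

lemma rotation_last:
  fixes n k :: nat
  assumes k: "0 < k" "k < n"
  shows "(n - 1) * k mod n = n - k"
proof -
  have eq: "(n - 1) * k = (n - k) + (k - 1) * n"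
  proof -
    obtain k' where "k = Suc k'" using k by (cases k) auto
    moreover obtain d where "n = k + d" using k less_imp_le le_Suc_ex by blast
    ultimately show ?thesis by (simp add: algebra_simps)
  qed
  have "(n - 1) * k mod n = (n - k) mod n" unfolding eq by (rule mod_mult_self1)
  also have "\<dots> = n - k" using k by simp
  finally show ?thesis .
qed

text \<open>With \<open>u\<close>, \<open>v\<close> and \<open>c = 1 - 1 / b\<close> as below, the
  inequalities say that the left branch sends \<open>u\<close> beyond \<open>1 - c\<close> and the
  right branch sends \<open>v\<close> below \<open>c\<close>. Thus the two halves of
  \<open>[u, v]\<close> fall into the blocks at 1 and at 0.\<close>

locale renormalizable =
  fixes n k :: nat and b \<alpha> :: real
  assumes n: "2 \<le> n" and k: "0 < k" "k < n" and coprime: "coprime n k" and b: "1 < b"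
    and lower: "1 / b < b * lo n k b \<alpha> (n - 1) + \<alpha>"
    and upper: "b * hi n k b \<alpha> (n - 1) + \<alpha> < 2 - 1 / b"
begin

abbreviation "p \<equiv> crit b \<alpha>"
abbreviation "x \<equiv> lo n k b \<alpha>"
abbreviation "y \<equiv> hi n k b \<alpha>"
abbreviation "\<delta> \<equiv> rot_digit n k"

definition "u = x (n - 1)"
definition "v = y (n - 1)"
definition "c = 1 - 1 / b"

lemma c: "0 < c" "c < 1" "b * c = b - 1"
  using b by (auto simp: c_def field_simps)

lemma bp: "b * p = 1 - \<alpha>"
  using b by (simp add: crit_def)

lemma y_eq: "y j = x j + b ^ j * c"
  by (simp add: hi_def c_def)

lemma y_Suc: "y (Suc j) = b * y j + \<alpha> - real (\<delta> j)"
  by (simp add: y_eq algebra_simps)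

lemma gap_lower: "b * (p - u) < c"
  using lower unfolding right_diff_distrib bp by (simp add: u_def c_def)

lemma gap_upper: "b * (v - p) < c"
  using upper unfolding right_diff_distrib bp by (simp add: v_def c_def)

lemma pow_n: "b ^ n = b ^ (n - 1) * b"
  using power_minus_mult[of n b] n by simp

lemma v_eq: "b * (v - u) = b ^ n * c"
  by (simp add: u_def v_def y_eq pow_n)

text \<open>The gaps \<open>b * (p - u)\<close> and \<open>b * (v - p)\<close> add up to
  \<open>b ^ n * c\<close>, which is at least \<open>c\<close>, and each of them is below
  \<open>c\<close>; so both are positive.\<close>

lemma u_less_p: "u < p" and p_less_v: "p < v"
proof -
  have "1 \<le> b ^ n" using b by simp
  then have "c \<le> b ^ n * c" using c by simp
  then have "c \<le> b * (v - p) + b * (p - u)" using v_eq by (simp add: algebra_simps)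
  then have "0 < b * (v - p)" "0 < b * (p - u)" using gap_lower gap_upper by linarith+
  then show "u < p" "p < v" using b by (auto simp: zero_less_mult_iff)
qed

section \<open>Residues modulo n and the order of the blocks\<close>

lemma mod_Suc_mult: "Suc i * k mod n = i * k mod n + k - n * \<delta> i"
proof -
  have r: "i * k mod n < n" using n by simp
  have "Suc i * k mod n = (i * k mod n + k) mod n" by (simp add: mod_simps add.commute)
  also have "\<dots> = i * k mod n + k - n * \<delta> i"
  proof (cases "n \<le> i * k mod n + k")
    case True
    then have "(i * k mod n + k) mod n = (i * k mod n + k - n) mod n" by (simp add: le_mod_geq)
    then show ?thesis using True r k by (simp add: rot_digit_def)
  qed (simp add: rot_digit_def)
  finally show ?thesis .
qed

text \<open>Otherwise the next residue would be 0, which by coprimality happens only after a full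
  turn.\<close>

lemma not_critical: "i < n - 1 \<Longrightarrow> i * k mod n + k \<noteq> n"
proof
  assume "i < n - 1" and "i * k mod n + k = n"
  then have "Suc i * k mod n = 0" using mod_Suc_mult[of i] by (simp add: rot_digit_def)
  then have "n dvd Suc i" using coprime by (metis coprime_dvd_mult_left_iff mod_0_imp_dvd)
  then show False using \<open>i < n - 1\<close> by (auto dest: dvd_imp_le)
qed

lemma rotation_surj: "q < n \<Longrightarrow> \<exists>l<n. l * k mod n = q"
proof -
  assume q: "q < n"
  have inj: "i = j" if "i \<le> j" "j < n" "i * k mod n = j * k mod n" for i j
  proof -
    have "n dvd j * k - i * k" using that mod_eq_dvd_iff_nat[of "i * k" "j * k" n] by simp
    then have "n dvd j - i" using coprime by (metis coprime_dvd_mult_left_iff diff_mult_distrib)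
    then show ?thesis using that by (auto dest: dvd_imp_le)
  qed
  have "inj_on (\<lambda>l. l * k mod n) {..<n}"
    by (rule inj_onI) (metis inj lessThan_iff nat_le_linear)
  then have "(\<lambda>l. l * k mod n) ` {..<n} = {..<n}"
    using n by (intro endo_inj_surj) auto
  then show ?thesis using q by (metis (no_types, lifting) imageE lessThan_iff)
qed

text \<open>The index \<open>n\<close> stands for the block adjacent to \<open>1\<close>, which is at the last position.\<close>

definition "pos i = (if i = n then n else i * k mod n)"
definition "lft i = (if i = n then 1 / b else x i)"
definition "adjacent = {(i, j). i < n \<and> 0 < j \<and> j \<le> n \<and> pos j = Suc (pos i)}"

lemma lft_less: "i < n \<Longrightarrow> lft i = x i"
  by (simp add: lft_def)

text \<open>The image of a gap between adjacent blocks is again such a gap, except that at the critical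
  block and at the ends \<open>0\<close> and \<open>1\<close> it can only be larger.\<close>

lemma adjacent_step:
  assumes "(i, j) \<in> adjacent"
  shows "\<exists>i' j'. (i', j') \<in> adjacent \<and> lft j' - y i' \<le> b * (lft j - y i)"
proof -
  have ij: "i < n" "0 < j" "j \<le> n" "pos j = Suc (pos i)"
    using assms by (auto simp: adjacent_def)
  have pi: "pos i = i * k mod n" using ij by (simp add: pos_def)
  have pos1: "pos 1 = k" "pos 0 = 0" using k n by (auto simp: pos_def)
  have posS: "pos (Suc l) = l * k mod n + k - n * \<delta> l" if "l < n - 1" for l
    using that mod_Suc_mult[of l] by (auto simp: pos_def)
  have \<delta>0: "\<delta> 0 = 0" using k by (simp add: rot_digit_def)
  have lft1: "lft 1 = \<alpha>" using n by (simp add: lft_def \<delta>0)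
  have y0: "y 0 = c" by (simp add: y_eq)
  have lftn: "lft n = 1 - c" by (simp add: lft_def c_def)
  have crit: "pos (n - 1) = n - k" using rotation_last[OF k] n by (simp add: pos_def)
  consider "i < n - 1" "j < n - 1" | "i < n - 1" "j = n - 1" | "i < n - 1" "j = n"
    | "i = n - 1" "j = n" | "i = n - 1" "j < n - 1" | "i = n - 1" "j = n - 1"
    using ij by linarith
  then show ?thesis
  proof cases
    \<comment> \<open>The threshold residue does not separate these neighbours, so both use the same
      branch.\<close>
    case 1
    have pj: "pos j = j * k mod n" using 1 by (simp add: pos_def)
    have "\<delta> j = \<delta> i"
      using not_critical[OF 1(2)] ij(4) unfolding pi pj by (auto simp: rot_digit_def)
    moreover have "n * \<delta> i \<le> i * k mod n + k" by (simp add: rot_digit_def)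
    ultimately have "pos (Suc j) = Suc (pos (Suc i))"
      using posS[OF 1(1)] posS[OF 1(2)] ij(4) unfolding pi pj by simp
    then have "(Suc i, Suc j) \<in> adjacent" using 1 by (auto simp: adjacent_def)
    moreover have "lft (Suc j) = b * lft j + \<alpha> - real (\<delta> i)"
      using 1 \<open>\<delta> j = \<delta> i\<close> by (simp add: lft_less)
    then have "lft (Suc j) - y (Suc i) = b * (lft j - y i)"
      by (simp add: y_Suc algebra_simps)
    ultimately show ?thesis by force
  next
    \<comment> \<open>The right neighbour is the critical block. The left branch sends
      \<open>u\<close> beyond \<open>1 - c\<close>, so the block at 1 can take its place.\<close>
    case 2
    have "pos i = n - k - 1" using ij(4) crit 2 by simp
    then have "i * k mod n + k = n - 1" using pi ij(4) crit 2 k by simp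
    then have "\<delta> i = 0" "pos (Suc i) = n - 1"
      using posS[OF 2(1)] n by (auto simp: rot_digit_def)
    then have "(Suc i, n) \<in> adjacent" using 2 n by (simp add: adjacent_def pos_def)
    moreover have "lft n - y (Suc i) \<le> b * (lft j - y i)"
    proof -
      have "lft j = u" using 2 n by (simp add: lft_less u_def)
      have "b * p - b * u < c" using gap_lower by (simp add: right_diff_distrib)
      then have "1 - c < b * u + \<alpha>" using bp by simp
      then show ?thesis using \<open>\<delta> i = 0\<close> \<open>lft j = u\<close> by (simp add: lftn y_Suc right_diff_distrib)
    qed
    ultimately show ?thesis by blast
  next
    \<comment> \<open>The branch with digit 1 sends the left end \<open>1 / b\<close> of the block
      at 1 to \<open>\<alpha>\<close>, the left end of block 1.\<close>
    case 3
    have pn: "i * k mod n = n - 1" using ij(4) 3 pi by (simp add: pos_def)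
    then have "\<delta> i = 1" using k by (simp add: rot_digit_def)
    then have "Suc (pos (Suc i)) = k" using posS[OF 3(1)] pn k n by simp
    then have "(Suc i, 1) \<in> adjacent" using 3 n pos1 by (simp add: adjacent_def)
    moreover have "lft 1 - y (Suc i) = b * (lft j - y i)"
      using 3 \<open>\<delta> i = 1\<close> lft1 b by (simp add: y_Suc right_diff_distrib) (simp add: lft_def)
    ultimately show ?thesis by force
  next
    \<comment> \<open>The critical block is the last one before the block at 1 only for
      \<open>k = 1\<close>; blocks 0 and 1 are then neighbours.\<close>
    case 4
    have "k = 1" using ij(4) 4 crit k by (simp add: pos_def)
    then have "(0, 1) \<in> adjacent" using n pos1 unfolding adjacent_def by auto
    moreover have "lft 1 - y 0 \<le> b * (lft j - y i)"
    proof -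
      have "b * v - b * p < c" using gap_upper by (simp add: right_diff_distrib)
      then have "b * v + \<alpha> < 1 + c" using bp by simp
      then show ?thesis using 4 lft1 lftn y0 c by (simp add: v_def right_diff_distrib)
    qed
    ultimately show ?thesis by blast
  next
    \<comment> \<open>The left neighbour is the critical block. The right branch sends
      \<open>v\<close> below \<open>c\<close>, the right end of block 0.\<close>
    case 5
    have pj: "pos j = j * k mod n" using 5 by (simp add: pos_def)
    then have "j * k mod n + k = Suc n" using ij(4) 5 crit k by simp
    then have "\<delta> j = 1" "pos (Suc j) = 1" using posS[OF 5(2)] by (auto simp: rot_digit_def)
    then have "(0, Suc j) \<in> adjacent" using 5 n pos1 by (simp add: adjacent_def)
    moreover have "lft (Suc j) - y 0 \<le> b * (lft j - y i)"
    proof -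
      have "b * v - b * p < c" using gap_upper by (simp add: right_diff_distrib)
      then have "b * v + \<alpha> < 1 + c" using bp by simp
      moreover have "lft (Suc j) = b * x j + \<alpha> - 1" "lft j = x j"
        using 5 \<open>\<delta> j = 1\<close> by (simp_all add: lft_less)
      ultimately show ?thesis using 5 y0 by (simp add: v_def right_diff_distrib)
    qed
    ultimately show ?thesis by blast
  next
    case 6
    then show ?thesis using ij by simp
  qed
qed

text \<open>A positive overlap would become at least \<open>b\<close> times larger with every step,
  while the finitely many pairs of neighbours bound all overlaps.\<close>

lemma adjacent_gap: "(i, j) \<in> adjacent \<Longrightarrow> y i \<le> lft j"
proof -
  assume ij: "(i, j) \<in> adjacent"
  define H where "H = (\<lambda>(i, j). y i - lft j)"
  have "finite adjacent"
    by (rule finite_subset[of _ "{..<n} \<times> {..n}"]) (auto simp: adjacent_def)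
  then have "H e \<le> Max (H ` adjacent)" if "e \<in> adjacent" for e
    using that by (intro Max_ge) auto
  moreover have "\<exists>e'. e' \<in> adjacent \<and> b * H e \<le> H e'" if "e \<in> adjacent" for e
  proof -
    obtain i j where e: "e = (i, j)" by force
    from adjacent_step[of i j] that e obtain i' j'
      where "(i', j') \<in> adjacent" "lft j' - y i' \<le> b * (lft j - y i)" by blast
    then show ?thesis unfolding e
      by (intro exI[of _ "(i', j')"]) (simp add: H_def right_diff_distrib)
  qed
  ultimately have "H (i, j) \<le> 0"
    using ij by (intro expanding_bounded_nonpos[OF b, where P = "\<lambda>e. e \<in> adjacent"])
  then show ?thesis by (simp add: H_def)
qed

text \<open>The rotation permutes the residues, so every position in between is taken by a block and
  the neighbouring gaps can be chained. Position 0 is never in between, so the intermediate blocks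
  have positive index.\<close>

lemma block_order:
  assumes "i < n" "0 < j" "j \<le> n" "pos i < pos j"
  shows "y i \<le> lft j"
  using assms
proof (induction "pos j - pos i" arbitrary: i rule: less_induct)
  case less
  show ?case
  proof (cases "pos j = Suc (pos i)")
    case True
    then show ?thesis using less.prems by (intro adjacent_gap) (simp add: adjacent_def)
  next
    case False
    have "pos j \<le> n" using n less_imp_le[OF mod_less_divisor] by (simp add: pos_def)
    then obtain l where l: "l < n" "l * k mod n = Suc (pos i)"
      using rotation_surj[of "Suc (pos i)"] less.prems False by auto
    then have pl: "pos l = Suc (pos i)" "0 < l" by (auto simp: pos_def intro: gr0I)
    then have "y i \<le> lft l" using less.prems l by (intro adjacent_gap) (simp add: adjacent_def)
    also have "lft l \<le> y l" using l b c by (simp add: lft_def y_eq)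
    also have "y l \<le> lft j" using pl l less.prems False by (intro less.hyps) auto
    finally show ?thesis .
  qed
qed

lemma block_left: "0 < j \<Longrightarrow> j < n - 1 \<Longrightarrow> \<delta> j = 0 \<Longrightarrow> y j \<le> u"
proof -
  assume j: "0 < j" "j < n - 1" "\<delta> j = 0"
  then have "pos j < pos (n - 1)" using rotation_last[OF k]
    by (auto simp: pos_def rot_digit_def split: if_splits)
  then have "y j \<le> lft (n - 1)" using j by (intro block_order) auto
  then show ?thesis using n by (simp add: lft_less u_def)
qed

lemma block_right: "0 < j \<Longrightarrow> j < n - 1 \<Longrightarrow> \<delta> j \<noteq> 0 \<Longrightarrow> v \<le> x j"
proof -
  assume j: "0 < j" "j < n - 1" "\<delta> j \<noteq> 0"
  then have "pos (n - 1) < pos j" using rotation_last[OF k] not_critical[of j] k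
    by (auto simp: pos_def rot_digit_def split: if_splits)
  then have "y (n - 1) \<le> lft j" using j by (intro block_order) auto
  then show ?thesis using j by (simp add: lft_less v_def)
qed

lemma \<delta>0: "\<delta> 0 = 0"
  using k by (simp add: rot_digit_def)

text \<open>Block 0 has length \<open>c\<close> and lies left of block 1, which starts at
  \<open>\<alpha>\<close>.\<close>

lemma \<alpha>_pos: "0 < \<alpha>"
proof -
  have "y 0 \<le> lft 1" using n k by (intro block_order) (auto simp: pos_def)
  then show ?thesis using n c by (simp add: y_eq lft_def \<delta>0)
qed

text \<open>Block 1 ends at \<open>\<alpha> + b - 1\<close> and lies left of the block at 1, which
  starts at \<open>1 / b\<close>.\<close>

lemma \<alpha>_less: "\<alpha> < 2 - b"
proof -
  have "y 1 \<le> lft n" using n k by (intro block_order) (auto simp: pos_def)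
  moreover have "y 1 = \<alpha> + b * c" using \<delta>0 by (simp add: y_eq)
  moreover have "lft n < 1" using b by (simp add: lft_def)
  ultimately show ?thesis using c by simp
qed

lemma c_less_p: "c < p" and p_less_c: "p < 1 - c"
proof -
  have "b * c < b * p" using c bp \<alpha>_less by simp
  then show "c < p" using b by simp
  have "b * p < b * (1 - c)" using c bp \<alpha>_pos by (simp add: right_diff_distrib)
  then show "p < 1 - c" using b by simp
qed

section \<open>Passage through the blocks and the n-th iterate on [u, v]\<close>

lemma T_left: "z < p \<Longrightarrow> T_plus b \<alpha> z = b * z + \<alpha>" "z < p \<Longrightarrow> T_minus b \<alpha> z = b * z + \<alpha>"
  and T_right: "p < z \<Longrightarrow> T_plus b \<alpha> z = b * z + \<alpha> - 1" "p < z \<Longrightarrow> T_minus b \<alpha> z = b * z + \<alpha> - 1"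
  by (simp_all add: T_plus_def T_minus_def)

lemma T_block:
  assumes T: "T = T_plus b \<alpha> \<or> T = T_minus b \<alpha>"
    and "0 < j" "j < n - 1" "x j \<le> z" "z \<le> y j"
  shows "T z = b * z + \<alpha> - real (\<delta> j)"
proof (cases "\<delta> j = 0")
  case True
  then have "z < p" using block_left[of j] assms u_less_p by simp
  then show ?thesis using T True by (auto simp: T_left)
next
  case False
  then have "p < z" using block_right[of j] assms p_less_v by auto
  moreover have "\<delta> j = 1" using False by (simp add: rot_digit_def split: if_splits)
  ultimately show ?thesis using T by (auto simp: T_right)
qed

text \<open>The point lands at distance \<open>b * e \<le> c\<close> from 0, so its later images
  remain inside the blocks, where the branch is known. Assuming the first step separately leaves
  room for either convention at \<open>p\<close>.\<close>

lemma funpow_right: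
  assumes T: "T = T_plus b \<alpha> \<or> T = T_minus b \<alpha>" and z: "T (p + e) = b * e"
    and e: "0 \<le> e" "b * e \<le> c" and "j < n"
  shows "(T ^^ Suc j) (p + e) = x j + b ^ j * (b * e)"
  using \<open>j < n\<close>
proof (induction j)
  case (Suc j)
  let ?z = "x j + b ^ j * (b * e)"
  have "(T ^^ Suc (Suc j)) (p + e) = T ?z" using Suc by simp
  also have "\<dots> = b * ?z + \<alpha> - real (\<delta> j)"
  proof (cases "j = 0")
    case True
    then have "?z < p" using e c_less_p by simp
    then show ?thesis using T True \<delta>0 by (auto simp: T_left)
  next
    case False
    have "b ^ j * (b * e) \<le> b ^ j * c" "0 \<le> b ^ j * (b * e)" using e b by (auto intro!: mult_left_mono)
    then show ?thesis using False Suc.prems by (intro T_block[OF T]) (auto simp: y_eq)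
  qed
  also have "\<dots> = x (Suc j) + b ^ Suc j * (b * e)" by (simp add: algebra_simps)
  finally show ?case .
qed (simp add: z)

text \<open>The first landing is next to 1, not next to \<open>y 0\<close>. The respective branches
  send 1 and \<open>y 0\<close> to the same point, so the formula with \<open>y j\<close> holds from
  the next step on.\<close>

lemma funpow_left:
  assumes T: "T = T_plus b \<alpha> \<or> T = T_minus b \<alpha>" and z: "T (p - e) = 1 - b * e"
    and e: "0 \<le> e" "b * e \<le> c" and "j < n"
  shows "(T ^^ Suc j) (p - e) = (if j = 0 then 1 else y j) - b ^ j * (b * e)"
  using \<open>j < n\<close>
proof (induction j)
  case (Suc j)
  let ?z = "(if j = 0 then 1 else y j) - b ^ j * (b * e)"
  have "(T ^^ Suc (Suc j)) (p - e) = T ?z" using Suc by simp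
  also have "\<dots> = y (Suc j) - b ^ Suc j * (b * e)"
  proof (cases "j = 0")
    case True
    then have "p < ?z" using e p_less_c by simp
    then have "T ?z = b * ?z + \<alpha> - 1" using T by (auto simp: T_right)
    then show ?thesis using True c by (simp add: y_Suc y_eq \<delta>0 algebra_simps)
  next
    case False
    have "b ^ j * (b * e) \<le> b ^ j * c" "0 \<le> b ^ j * (b * e)" using e b by (auto intro!: mult_left_mono)
    then have "T ?z = b * ?z + \<alpha> - real (\<delta> j)"
      using False Suc.prems by (intro T_block[OF T]) (auto simp: y_eq)
    then show ?thesis using False by (simp add: y_Suc algebra_simps)
  qed
  finally show ?case by simp
qed (simp add: z)

lemma renormalized_right:
  assumes T: "T = T_plus b \<alpha> \<and> p \<le> z \<or> T = T_minus b \<alpha> \<and> p < z" and "z \<le> v"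
  shows "(T ^^ n) z = u + b ^ n * (z - p)"
proof -
  have "b * (z - p) \<le> b * (v - p)" using assms b by simp
  then have "b * (z - p) \<le> c" using gap_upper by simp
  moreover have "T (p + (z - p)) = b * (z - p)"
    using T bp by (auto simp: T_plus_def T_minus_def right_diff_distrib)
  ultimately have "(T ^^ Suc (n - 1)) (p + (z - p)) = x (n - 1) + b ^ (n - 1) * (b * (z - p))"
    using T n by (intro funpow_right) auto
  moreover have "Suc (n - 1) = n" "b ^ (n - 1) * (b * (z - p)) = b ^ n * (z - p)"
    using n pow_n by simp_all
  moreover have "p + (z - p) = z" by simp
  ultimately show ?thesis unfolding u_def by metis
qed

lemma renormalized_left:
  assumes T: "T = T_plus b \<alpha> \<and> z < p \<or> T = T_minus b \<alpha> \<and> z \<le> p" and "u \<le> z"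
  shows "(T ^^ n) z = v - b ^ n * (p - z)"
proof -
  have "b * (p - z) \<le> b * (p - u)" using assms b by simp
  then have "b * (p - z) \<le> c" using gap_lower by simp
  moreover have "T (p - (p - z)) = 1 - b * (p - z)"
    using T bp by (auto simp: T_plus_def T_minus_def right_diff_distrib)
  ultimately have "(T ^^ Suc (n - 1)) (p - (p - z)) =
      (if n - 1 = 0 then 1 else y (n - 1)) - b ^ (n - 1) * (b * (p - z))"
    using T n by (intro funpow_left) auto
  moreover have "Suc (n - 1) = n" "n - 1 \<noteq> 0" "b ^ (n - 1) * (b * (p - z)) = b ^ n * (p - z)"
    using n pow_n by simp_all
  moreover have "p - (p - z) = z" by simp
  ultimately show ?thesis unfolding v_def by metis
qed

text \<open>Each half of \<open>[u, v]\<close> is shorter than \<open>c / b\<close>; stretched by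
  \<open>b ^ n\<close> it still fits, because \<open>b * (v - u) = b ^ n * c\<close>.\<close>

lemma renormalized_mem:
  assumes "z \<in> {u..v}"
  shows "p \<le> z \<Longrightarrow> u + b ^ n * (z - p) \<in> {u..v}"
    and "z \<le> p \<Longrightarrow> v - b ^ n * (p - z) \<in> {u..v}"
proof -
  have b_mult: "b * (b ^ n * d) \<le> b * (v - u)" if "b * d \<le> c" for d
  proof -
    have "b * (b ^ n * d) = b ^ n * (b * d)" by simp
    also have "\<dots> \<le> b ^ n * c" using b that by (intro mult_left_mono) auto
    finally show ?thesis using v_eq by simp
  qed
  have "b ^ n * (z - p) \<le> v - u"
  proof -
    have "b * (z - p) \<le> b * (v - p)" using assms b by simp
    then have "b * (b ^ n * (z - p)) \<le> b * (v - u)" using gap_upper by (intro b_mult) simp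
    then show ?thesis using b by simp
  qed
  moreover have "b ^ n * (p - z) \<le> v - u"
  proof -
    have "b * (p - z) \<le> b * (p - u)" using assms b by simp
    then have "b * (b ^ n * (p - z)) \<le> b * (v - u)" using gap_lower by (intro b_mult) simp
    then show ?thesis using b by simp
  qed
  ultimately show "p \<le> z \<Longrightarrow> u + b ^ n * (z - p) \<in> {u..v}"
    and "z \<le> p \<Longrightarrow> v - b ^ n * (p - z) \<in> {u..v}"
    using b by auto
qed

lemma T_crit: "T_plus b \<alpha> p = 0" "T_minus b \<alpha> p = 1"
  using bp by (auto simp: T_plus_def T_minus_def)

lemma funpow_crit: "(T_plus b \<alpha> ^^ n) p = u" "(T_minus b \<alpha> ^^ n) p = v"
  using renormalized_right[of "T_plus b \<alpha>" p] renormalized_left[of "T_minus b \<alpha>" p]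
    u_less_p p_less_v by auto

lemma renormalized_plus:
  "z \<in> {u..v} \<Longrightarrow>
    (T_plus b \<alpha> ^^ n) z = (if z < p then v - b ^ n * (p - z) else u + b ^ n * (z - p))"
  using renormalized_left[of "T_plus b \<alpha>" z] renormalized_right[of "T_plus b \<alpha>" z] by auto

lemma renormalized_minus:
  "z \<in> {u..v} \<Longrightarrow>
    (T_minus b \<alpha> ^^ n) z = (if z \<le> p then v - b ^ n * (p - z) else u + b ^ n * (z - p))"
  using renormalized_left[of "T_minus b \<alpha>" z] renormalized_right[of "T_minus b \<alpha>" z] by auto

lemma renormalized_funpow_mem:
  assumes "z \<in> {u..v}"
  shows "((T_plus b \<alpha> ^^ n) ^^ i) z \<in> {u..v}" "((T_minus b \<alpha> ^^ n) ^^ i) z \<in> {u..v}"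
proof -
  have "(T_plus b \<alpha> ^^ n) z \<in> {u..v}" if "z \<in> {u..v}" for z
    using renormalized_mem[OF that] unfolding renormalized_plus[OF that] by (simp del: atLeastAtMost_iff)
  then show "((T_plus b \<alpha> ^^ n) ^^ i) z \<in> {u..v}"
    using assms by (induction i) (simp_all del: atLeastAtMost_iff)
  have "(T_minus b \<alpha> ^^ n) z \<in> {u..v}" if "z \<in> {u..v}" for z
    using renormalized_mem[OF that] unfolding renormalized_minus[OF that] by (simp del: atLeastAtMost_iff)
  then show "((T_minus b \<alpha> ^^ n) ^^ i) z \<in> {u..v}"
    using assms by (induction i) (simp_all del: atLeastAtMost_iff)
qed

end

section \<open>The parameter interval\<close>

lemma rot_digit_div:
  assumes "0 < k" "k < n"
  shows "Suc i * k div n = i * k div n + rot_digit n k i"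
proof -
  define q r where "q = i * k div n" and "r = i * k mod n"
  have ik: "i * k = n * q + r" "r < n" using assms by (auto simp: q_def r_def)
  have "Suc i * k div n = q + rot_digit n k i"
    by (rule div_nat_eqI) (use ik assms in \<open>auto simp: rot_digit_def r_def[symmetric]\<close>)
  then show ?thesis by (simp add: q_def)
qed

text \<open>The digit at \<open>i\<close> is 1 exactly when \<open>i * k div n\<close> is about to
  jump to some \<open>q\<close>, that is, when \<open>Suc i\<close> is the ceiling of
  \<open>q * n / k\<close>, here written \<open>(q * n + k - 1) div k\<close>.\<close>

lemma sum_rot_digit:
  fixes f :: "nat \<Rightarrow> real"
  assumes "0 < k" "k < n"
  shows "(\<Sum>i<N. real (rot_digit n k i) * f (Suc i)) = (\<Sum>q = 1..N * k div n. f ((q * n + k - 1) div k))"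
proof (induction N)
  case (Suc N)
  consider "rot_digit n k N = 0" | "rot_digit n k N = 1"
    by (cases "n \<le> N * k mod n + k") (auto simp: rot_digit_def)
  then show ?case
  proof cases
    case 2
    define q where "q = Suc N * k div n"
    have q: "q = Suc (N * k div n)" using rot_digit_div[OF assms] 2 by (simp add: q_def)
    have "q * n \<le> Suc N * k" by (simp add: q_def)
    moreover have "N * k < q * n"
      using assms dividend_less_times_div[of n "N * k"] q by (simp add: algebra_simps)
    ultimately have "(q * n + k - 1) div k = Suc N"
      using assms by (intro div_nat_eqI) (auto simp: algebra_simps)
    then show ?thesis using Suc 2 q unfolding q_def[symmetric] by simp
  qed (use Suc rot_digit_div[OF assms, of N] in simp)
qed simp

text \<open>The \<open>j\<close>-th summand collects the \<open>q\<close> with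
  \<open>V n k (j - 1) < q \<le> V n k j\<close>. For these, \<open>q * s\<close> is above
  \<open>(j - 1) * k\<close> and at most \<open>j * k\<close>, so with \<open>n = l * k + s\<close>
  the ceiling of \<open>q * n / k\<close> is \<open>q * l + j\<close>. The exponents then agree
  because \<open>V n k s = k\<close>.\<close>

lemma sum_W_partial:
  assumes k: "0 < k" and s: "0 < n mod k" and "r \<le> n mod k"
  shows "(\<Sum>j = 1..r. W n k b j) = (\<Sum>q = 1..V n k r. b ^ (n - (q * n + k - 1) div k))"
  using \<open>r \<le> n mod k\<close>
proof (induction r)
  case (Suc r)
  define s l where "s = n mod k" and "l = n div k"
  have n: "n = l * k + s" and "0 < s" using assms by (auto simp: s_def l_def)
  have V: "V n k j * s \<le> j * k" "j * k < Suc (V n k j) * s" for j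
    using \<open>0 < s\<close> dividend_less_times_div[of s "j * k"] by (auto simp: V_def s_def mult.commute)
  have mono: "V n k r \<le> V n k (Suc r)" "V n k (Suc r) \<le> k"
  proof -
    show "V n k r \<le> V n k (Suc r)" unfolding V_def by (intro div_le_mono) simp
    have "V n k (Suc r) * s \<le> Suc r * k" by (rule V)
    also have "\<dots> \<le> s * k" using Suc.prems unfolding s_def by (rule mult_le_mono1)
    finally have "V n k (Suc r) * s \<le> k * s" by (simp add: mult.commute)
    then show "V n k (Suc r) \<le> k" using \<open>0 < s\<close> by (rule mult_right_le_imp_le)
  qed
  have Vs: "V n k s = k" using \<open>0 < s\<close> by (simp add: V_def s_def)
  have expo: "(V n k s - V n k r - i) * l + (s - Suc r) = n - ((V n k r + i) * n + k - 1) div k"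
    if "1 \<le> i" "i \<le> h n k (Suc r)" for i
  proof -
    define q where "q = V n k r + i"
    have q: "Suc (V n k r) \<le> q" "q \<le> V n k (Suc r)" using that mono by (auto simp: q_def h_def)
    have "q * s \<le> Suc r * k" by (rule le_trans[OF mult_le_mono1[OF q(2)] V(1)])
    moreover have "r * k < q * s" by (rule less_le_trans[OF V(2) mult_le_mono1[OF q(1)]])
    ultimately have "(q * n + k - 1) div k = q * l + Suc r"
      using k unfolding n by (intro div_nat_eqI) (auto simp: algebra_simps)
    moreover obtain d where "k = q + d" using q mono le_Suc_ex by (meson le_trans)
    moreover obtain e where "s = Suc r + e" using Suc.prems le_Suc_ex s_def by metis
    ultimately have "(k - q) * l + (s - Suc r) = n - (q * n + k - 1) div k"
      using n by (simp add: algebra_simps)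
    then show ?thesis by (simp add: q_def Vs)
  qed
  have "W n k b (Suc r) = (\<Sum>i = 1..h n k (Suc r). b ^ (n - ((V n k r + i) * n + k - 1) div k))"
    unfolding W_def s_def[symmetric] l_def[symmetric] diff_Suc_1
    by (intro sum.cong refl arg_cong[where f = "\<lambda>e. b ^ e"] expo) auto
  also have "\<dots> = (\<Sum>q = V n k r + 1..V n k (Suc r). b ^ (n - (q * n + k - 1) div k))"
    using mono by (intro sum.reindex_bij_witness[of _ "\<lambda>q. q - V n k r" "\<lambda>i. V n k r + i"])
      (auto simp: h_def)
  finally have W: "W n k b (Suc r) = \<dots>" .
  have "(\<Sum>j = 1..Suc r. W n k b j) = (\<Sum>j = 1..r. W n k b j) + W n k b (Suc r)" by simp
  also have "\<dots> = (\<Sum>q = 1..V n k r. b ^ (n - (q * n + k - 1) div k)) +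
      (\<Sum>q = V n k r + 1..V n k (Suc r). b ^ (n - (q * n + k - 1) div k))"
    using Suc W by simp
  also have "\<dots> = (\<Sum>q = 1..V n k (Suc r). b ^ (n - (q * n + k - 1) div k))"
    using sum.ub_add_nat[of 1 "V n k r" "\<lambda>q. b ^ (n - (q * n + k - 1) div k)" "V n k (Suc r) - V n k r"]
      mono by simp
  finally show ?case .
qed (simp add: V_def)

text \<open>One turn of the rotation read as a number in base \<open>b\<close>. It also covers
  \<open>k = 1\<close>, where the sum of the \<open>W n k b j\<close> is empty.\<close>

definition rot_sum :: "nat \<Rightarrow> nat \<Rightarrow> real \<Rightarrow> real" where
  "rot_sum n k b = (\<Sum>i<n. real (rot_digit n k i) * b ^ (n - Suc i))"

lemma rot_sum_eq:
  assumes "0 < k" "k < n"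
  shows "rot_sum n k b = (\<Sum>q = 1..k. b ^ (n - (q * n + k - 1) div k))"
  using sum_rot_digit[OF assms, of "\<lambda>i. b ^ (n - i)" n] assms by (simp add: rot_sum_def)

lemma sum_W:
  assumes "2 \<le> k" "k < n" "coprime n k"
  shows "(\<Sum>j = 1..n mod k. W n k b j) = rot_sum n k b"
proof -
  have "n mod k \<noteq> 0"
  proof
    assume "n mod k = 0"
    then have "k dvd n" by auto
    then have "is_unit k" using assms(3) by (meson coprime_def dvd_refl)
    then show False using assms by simp
  qed
  moreover have "V n k (n mod k) = k" using \<open>n mod k \<noteq> 0\<close> by (simp add: V_def)
  ultimately show ?thesis
    using sum_W_partial[of k n "n mod k" b] rot_sum_eq[of k n b] assms by simp
qed

text \<open>For \<open>k = 1\<close> the only digit 1 of a turn is the last one, so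
  \<open>rot_sum\<close> is 1 and the separate formula becomes an instance of the general
  one.\<close>

lemma param_interval_eq:
  assumes "2 \<le> n" "0 < k" "k < n" "coprime n k"
  shows "param_interval n k b =
    {(1 + b * (rot_sum n k b - 1)) / (b * (\<Sum>i<n. b ^ i))..
     (b * rot_sum n k b - b ^ (n + 1) + b ^ n + b - 1) / (b * (\<Sum>i<n. b ^ i))}"
proof (cases "k = 1")
  case True
  have "rot_sum n 1 b = 1" using rot_sum_eq[of 1 n b] assms by simp
  then show ?thesis using True by (simp add: param_interval_def Let_def algebra_simps)
next
  case False
  then have "(\<Sum>j = 1..n mod k. W n k b j) = rot_sum n k b" using assms by (intro sum_W) auto
  then show ?thesis using False unfolding param_interval_def Let_def by simp
qed

lemma lo_closed_form:
  "lo n k b \<alpha> j = \<alpha> * (\<Sum>i<j. b ^ i) - (\<Sum>i<j. real (rot_digit n k i) * b ^ (j - Suc i))"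
proof (induction j)
  case (Suc j)
  have "(\<Sum>i<Suc j. b ^ i) = 1 + b * (\<Sum>i<j. b ^ i)" (is "?D' = 1 + b * ?D")
    by (simp only: sum.lessThan_Suc_shift) (simp add: sum_distrib_left)
  moreover have "(\<Sum>i<j. real (rot_digit n k i) * b ^ (j - i)) =
      b * (\<Sum>i<j. real (rot_digit n k i) * b ^ (j - Suc i))" (is "?R' = b * ?R")
    unfolding sum_distrib_left
  proof (rule sum.cong)
    fix i assume "i \<in> {..<j}"
    then have "b ^ (j - i) = b * b ^ (j - Suc i)" by (simp add: Suc_diff_Suc flip: power_Suc)
    then show "real (rot_digit n k i) * b ^ (j - i) = b * (real (rot_digit n k i) * b ^ (j - Suc i))"
      by simp
  qed simp
  then have "(\<Sum>i<Suc j. real (rot_digit n k i) * b ^ (Suc j - Suc i)) = b * ?R + real (rot_digit n k j)"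
    by simp
  moreover have "lo n k b \<alpha> (Suc j) = \<alpha> * (1 + b * ?D) - (b * ?R + real (rot_digit n k j))"
    by (simp only: lo.simps Suc.IH) (simp add: algebra_simps)
  ultimately show ?case by simp
qed simp

text \<open>The rotation has digit 1 at \<open>n - 1\<close>; taking the branch with digit 0 there
  gives one more than \<open>lo n k b \<alpha> n\<close>.\<close>

lemma lo_last:
  assumes "0 < k" "k < n"
  shows "b * lo n k b \<alpha> (n - 1) + \<alpha> = 1 + \<alpha> * (\<Sum>i<n. b ^ i) - rot_sum n k b"
proof -
  have last: "rot_digit n k (n - 1) = 1"
    using assms by (simp add: rot_digit_def rotation_last[OF assms, simplified])
  have "n = Suc (n - 1)" using assms by simp
  then have "lo n k b \<alpha> n = b * lo n k b \<alpha> (n - 1) + \<alpha> - 1"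
    using last by (metis lo.simps(2) of_nat_1)
  then show ?thesis by (simp add: lo_closed_form rot_sum_def)
qed

text \<open>Multiplied by \<open>b\<close> and rewritten through \<open>rot_sum\<close>, the two
  locale inequalities become comparisons of \<open>\<alpha>\<close> with the two endpoints.\<close>

lemma renormalizable_interior:
  assumes "2 \<le> n" "0 < k" "k < n" "coprime n k" and b: "1 < b"
    and \<alpha>: "(1 + b * (rot_sum n k b - 1)) / (b * (\<Sum>i<n. b ^ i)) < \<alpha>"
      "\<alpha> < (b * rot_sum n k b - b ^ (n + 1) + b ^ n + b - 1) / (b * (\<Sum>i<n. b ^ i))"
  shows "renormalizable n k b \<alpha>"
proof
  define D where "D = (\<Sum>i<n. b ^ i)"
  have "0 < D" unfolding D_def using assms by (intro sum_pos) auto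
  have "n = Suc (n - 1)" using assms by simp
  have u: "b * lo n k b \<alpha> (n - 1) + \<alpha> = 1 + \<alpha> * D - rot_sum n k b"
    using lo_last[OF assms(2,3)] by (simp add: D_def)
  have "1 + b * (rot_sum n k b - 1) < \<alpha> * (b * D)"
    using \<alpha>(1) \<open>0 < D\<close> b unfolding D_def[symmetric] by (subst (asm) pos_divide_less_eq) auto
  then have "1 < b * (b * lo n k b \<alpha> (n - 1) + \<alpha>)" unfolding u by (simp add: algebra_simps)
  then show "1 / b < b * lo n k b \<alpha> (n - 1) + \<alpha>" using b by (simp add: field_simps)
  have "\<alpha> * (b * D) < b * rot_sum n k b - b ^ (n + 1) + b ^ n + b - 1"
    using \<alpha>(2) \<open>0 < D\<close> b unfolding D_def[symmetric] by (subst (asm) pos_less_divide_eq) auto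
  then have "b * (b * lo n k b \<alpha> (n - 1) + \<alpha>) < 2 * b - 1 - b ^ (n + 1) + b ^ n"
    unfolding u by (simp add: algebra_simps)
  moreover have "b ^ n = b * b ^ (n - 1)" using \<open>n = Suc (n - 1)\<close> by (metis power_Suc)
  then have "b * (b * hi n k b \<alpha> (n - 1) + \<alpha>) =
      b * (b * lo n k b \<alpha> (n - 1) + \<alpha>) + b ^ (n + 1) - b ^ n"
    using b by (simp add: hi_def field_simps)
  ultimately have "b * (b * hi n k b \<alpha> (n - 1) + \<alpha>) < 2 * b - 1" by simp
  then show "b * hi n k b \<alpha> (n - 1) + \<alpha> < 2 - 1 / b" using b by (simp add: field_simps)
qed (use assms in auto)

text \<open>The numerators differ by \<open>(b - 1) * (2 - b ^ n)\<close>.\<close>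

lemma interval_nonempty:
  fixes b :: real
  assumes "1 < b" "b ^ n < 2" "0 < n"
  shows "(1 + b * (S - 1)) / (b * (\<Sum>i<n. b ^ i)) <
    (b * S - b ^ (n + 1) + b ^ n + b - 1) / (b * (\<Sum>i<n. b ^ i))"
proof -
  have "0 < b * (\<Sum>i<n. b ^ i)" using assms by (intro mult_pos_pos sum_pos) auto
  moreover have "0 < (b - 1) * (2 - b ^ n)" using assms by simp
  then have "1 + b * (S - 1) < b * S - b ^ (n + 1) + b ^ n + b - 1" by (simp add: algebra_simps)
  ultimately show ?thesis by (intro divide_strict_right_mono)
qed

lemma dense_subset_interval:
  fixes A B :: real
  assumes "A < B" and ex: "\<And>a c. A \<le> a \<Longrightarrow> a < c \<Longrightarrow> c \<le> B \<Longrightarrow> \<exists>t. a < t \<and> t < c \<and> P t"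
  shows "dense_subset {t. A < t \<and> t < B \<and> P t} {A..B}"
  unfolding dense_subset_def
proof (intro conjI subsetI)
  fix t assume t: "t \<in> {A..B}"
  show "t \<in> closure {t. A < t \<and> t < B \<and> P t}"
    unfolding closure_approachable
  proof (intro allI impI)
    fix e :: real assume "0 < e"
    then obtain t' where "max A (t - e) < t'" "t' < min B (t + e)" "P t'"
      using ex[of "max A (t - e)" "min B (t + e)"] t \<open>A < B\<close> by auto
    then show "\<exists>t'\<in>{t. A < t \<and> t < B \<and> P t}. dist t' t < e"
      by (intro bexI[of _ t']) (auto simp: dist_real_def)
  qed
qed auto

section \<open>Matching for multinacci numbers\<close>

text \<open>Existence is a sign change between 1 and 2. For uniqueness, the quotient of
  \<open>x ^ m\<close> by the sum of the lower powers is increasing, which is checked term by term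
  after cross-multiplication.\<close>

lemma multinacci:
  assumes "2 \<le> m"
  shows "1 < multinacci m" "multinacci m < 2" "multinacci m ^ m = (\<Sum>i<m. multinacci m ^ i)"
proof -
  let ?P = "\<lambda>x::real. 1 < x \<and> x < 2 \<and> x ^ m = (\<Sum>i<m. x ^ i)"
  define f where "f x = x ^ m - (\<Sum>i<m. x ^ i)" for x :: real
  have f1: "f 1 < 0" using assms by (simp add: f_def)
  have f2: "f 2 = 1" using geometric_sum[of "2::real" m] by (simp add: f_def)
  have "continuous_on {1..2} f" unfolding f_def by (intro continuous_intros)
  then obtain x where x: "1 \<le> x" "x \<le> 2" "f x = 0"
    using IVT'[of f 1 0 2] f1 f2 by auto
  have "x \<noteq> 1" "x \<noteq> 2" using x f1 f2 by auto
  then have ex: "?P x" using x by (simp add: f_def)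
  have less: False if "?P x" "?P y" "x < y" for x y :: real
  proof -
    have "(\<Sum>i<m. y ^ i * x ^ m) < (\<Sum>i<m. x ^ i * y ^ m)"
    proof (rule sum_strict_mono)
      fix i assume "i \<in> {..<m}"
      then have "0 < m - i" "m = i + (m - i)" by auto
      then have "x ^ (m - i) < y ^ (m - i)" "x ^ m = x ^ i * x ^ (m - i)" "y ^ m = y ^ i * y ^ (m - i)"
        using that by (auto intro: power_strict_mono simp flip: power_add)
      then show "y ^ i * x ^ m < x ^ i * y ^ m" using that by (simp add: mult.assoc mult.left_commute)
    qed (use assms in \<open>auto simp: lessThan_empty_iff\<close>)
    then have "y ^ m * x ^ m < x ^ m * y ^ m" using that by (simp flip: sum_distrib_right)
    then show False by simp
  qed
  have "?P (multinacci m)"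
    unfolding multinacci_def by (rule theI[of ?P, OF ex]) (metis ex less linorder_neqE)
  then show "1 < multinacci m" "multinacci m < 2" "multinacci m ^ m = (\<Sum>i<m. multinacci m ^ i)"
    by auto
qed

section \<open>Parameters for which the orbit of 0 meets the critical point\<close>

lemma T_plus_unit_interval:
  assumes "1 < b" "0 \<le> \<alpha>" "\<alpha> \<le> 2 - b"
  shows "(T_plus b \<alpha> ^^ i) 0 \<in> {0..1}"
proof (induction i)
  case (Suc i)
  define z where "z = (T_plus b \<alpha> ^^ i) 0"
  have z: "0 \<le> z" "z \<le> 1" using Suc by (auto simp: z_def)
  define t where "t = b * z"
  have "t \<le> b" "0 \<le> t" using z assms by (auto simp: t_def mult_left_le)
  moreover have "z < crit b \<alpha> \<longleftrightarrow> t < 1 - \<alpha>" using assms by (simp add: t_def crit_def field_simps)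
  then have "T_plus b \<alpha> z = (if t < 1 - \<alpha> then t + \<alpha> else t + \<alpha> - 1)"
    by (simp add: T_plus_def t_def)
  ultimately have "T_plus b \<alpha> z \<in> {0..1}" using assms by auto
  then show ?case by (simp add: z_def)
qed simp

text \<open>Without a hit, no orbit point changes sides of the critical point as
  \<open>\<alpha>\<close> varies, so all digits are constant on a compact subinterval. The orbit
  points are then affine in \<open>\<alpha>\<close> with slope \<open>A i \<ge> i\<close>, yet they
  stay in the unit interval.\<close>

lemma ex_hit:
  assumes "1 < b" "a < c" and range: "\<And>\<alpha>. a < \<alpha> \<Longrightarrow> \<alpha> < c \<Longrightarrow> 0 \<le> \<alpha> \<and> \<alpha> \<le> 2 - b"
  shows "\<exists>\<alpha> i. a < \<alpha> \<and> \<alpha> < c \<and> (T_plus b \<alpha> ^^ i) 0 = crit b \<alpha>"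
proof (rule ccontr)
  assume none: "\<not> ?thesis"
  obtain \<alpha>1 where \<alpha>1: "a < \<alpha>1" "\<alpha>1 < c" using dense[OF \<open>a < c\<close>] by blast
  obtain \<alpha>2 where \<alpha>2: "\<alpha>1 < \<alpha>2" "\<alpha>2 < c" using dense[OF \<alpha>1(2)] by blast
  define A where "A i = (\<Sum>l<i. b ^ l)" for i :: nat
  have A_Suc: "A (Suc i) = b * A i + 1" for i
    unfolding A_def by (simp only: sum.lessThan_Suc_shift) (simp add: sum_distrib_left)
  have "\<exists>C. \<forall>\<alpha>\<in>{\<alpha>1..\<alpha>2}. (T_plus b \<alpha> ^^ i) 0 = A i * \<alpha> - C" for i
  proof (induction i)
    case 0
    show ?case by (intro exI[of _ 0]) (simp add: A_def)
  next
    case (Suc i)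
    then obtain C where C: "\<And>\<alpha>. \<alpha> \<in> {\<alpha>1..\<alpha>2} \<Longrightarrow> (T_plus b \<alpha> ^^ i) 0 = A i * \<alpha> - C" by blast
    \<comment> \<open>The parameter at which the affine orbit point would equal
      \<open>(1 - \<alpha>) / b\<close>.\<close>
    define z where "z = (C + 1 / b) / (A i + 1 / b)"
    have pos: "0 < A i + 1 / b"
      using \<open>1 < b\<close> by (intro add_nonneg_pos) (auto simp: A_def intro!: sum_nonneg)
    have cmp: "A i * \<alpha> - C - crit b \<alpha> = (A i + 1 / b) * (\<alpha> - z)" for \<alpha>
      using pos \<open>1 < b\<close> by (simp add: z_def crit_def right_diff_distrib) (simp add: field_simps)
    have "z \<notin> {\<alpha>1..\<alpha>2}"
    proof
      assume z: "z \<in> {\<alpha>1..\<alpha>2}"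
      then have "(T_plus b z ^^ i) 0 = crit b z" using C[OF z] cmp[of z] by simp
      moreover have "a < z" "z < c" using z \<alpha>1 \<alpha>2 by auto
      ultimately show False using none by blast
    qed
    then consider "z < \<alpha>1" | "\<alpha>2 < z" by force
    then show ?case
    proof cases
      case 1
      have "(T_plus b \<alpha> ^^ Suc i) 0 = A (Suc i) * \<alpha> - (b * C + 1)" if "\<alpha> \<in> {\<alpha>1..\<alpha>2}" for \<alpha>
      proof -
        have "0 < (A i + 1 / b) * (\<alpha> - z)" using that 1 pos by simp
        then have "\<not> (T_plus b \<alpha> ^^ i) 0 < crit b \<alpha>" using C[OF that] cmp[of \<alpha>] by simp
        moreover have "b * (T_plus b \<alpha> ^^ i) 0 = b * A i * \<alpha> - b * C"
          unfolding C[OF that] by (simp add: algebra_simps)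
        ultimately show ?thesis by (simp add: T_plus_def A_Suc distrib_right)
      qed
      then show ?thesis by blast
    next
      case 2
      have "(T_plus b \<alpha> ^^ Suc i) 0 = A (Suc i) * \<alpha> - b * C" if "\<alpha> \<in> {\<alpha>1..\<alpha>2}" for \<alpha>
      proof -
        have "(A i + 1 / b) * (\<alpha> - z) < 0" using that 2 pos by (simp add: mult_pos_neg)
        then have "(T_plus b \<alpha> ^^ i) 0 < crit b \<alpha>" using C[OF that] cmp[of \<alpha>] by simp
        moreover have "b * (T_plus b \<alpha> ^^ i) 0 = b * A i * \<alpha> - b * C"
          unfolding C[OF that] by (simp add: algebra_simps)
        ultimately show ?thesis by (simp add: T_plus_def A_Suc distrib_right)
      qed
      then show ?thesis by blast
    qed
  qed
  then have bounded: "A i * (\<alpha>2 - \<alpha>1) \<le> 1" for i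
  proof -
    obtain C where "\<forall>\<alpha>\<in>{\<alpha>1..\<alpha>2}. (T_plus b \<alpha> ^^ i) 0 = A i * \<alpha> - C"
      using \<open>\<And>i. \<exists>C. \<forall>\<alpha>\<in>{\<alpha>1..\<alpha>2}. (T_plus b \<alpha> ^^ i) 0 = A i * \<alpha> - C\<close> by blast
    then have "(T_plus b \<alpha>1 ^^ i) 0 = A i * \<alpha>1 - C" "(T_plus b \<alpha>2 ^^ i) 0 = A i * \<alpha>2 - C"
      using \<alpha>2 by auto
    moreover have "(T_plus b \<alpha>1 ^^ i) 0 \<in> {0..1}" "(T_plus b \<alpha>2 ^^ i) 0 \<in> {0..1}"
      using \<alpha>1 \<alpha>2 range by (auto intro!: T_plus_unit_interval[OF \<open>1 < b\<close>] simp del: atLeastAtMost_iff)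
    ultimately show ?thesis by (simp add: right_diff_distrib)
  qed
  obtain i where "1 / (\<alpha>2 - \<alpha>1) < real i" using reals_Archimedean2 by blast
  then have "1 < real i * (\<alpha>2 - \<alpha>1)" using \<alpha>2 by (simp add: field_simps)
  also have "real i \<le> A i"
    unfolding A_def using \<open>1 < b\<close> sum_mono[of "{..<i}" "\<lambda>_. 1" "\<lambda>l. b ^ l"] by simp
  then have "real i * (\<alpha>2 - \<alpha>1) \<le> A i * (\<alpha>2 - \<alpha>1)" using \<alpha>2 by (intro mult_right_mono) auto
  finally show False using bounded[of i] by simp
qed

text \<open>Finitely many digit strings are possible. Each makes the orbit point affine in
  \<open>\<alpha>\<close> with nonnegative slope, whereas the critical point has slope
  \<open>- 1 / b\<close>, so the two lines cross once.\<close>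

lemma finite_hit:
  assumes "1 < b"
  shows "finite {\<alpha>. (T_plus b \<alpha> ^^ i) 0 = crit b \<alpha>}"
proof -
  define A where "A i = (\<Sum>l<i. b ^ l)" for i :: nat
  have A_Suc: "A (Suc i) = b * A i + 1" for i
    unfolding A_def by (simp only: sum.lessThan_Suc_shift) (simp add: sum_distrib_left)
  have "\<exists>F. finite F \<and> (\<forall>\<alpha>. \<exists>C\<in>F. (T_plus b \<alpha> ^^ i) 0 = A i * \<alpha> - C)"
  proof (induction i)
    case 0
    show ?case by (intro exI[of _ "{0}"]) (simp add: A_def)
  next
    case (Suc i)
    then obtain F where F: "finite F" "\<And>\<alpha>. \<exists>C\<in>F. (T_plus b \<alpha> ^^ i) 0 = A i * \<alpha> - C" by blast
    have "\<exists>C\<in>(\<lambda>C. b * C) ` F \<union> (\<lambda>C. b * C + 1) ` F. (T_plus b \<alpha> ^^ Suc i) 0 = A (Suc i) * \<alpha> - C" for \<alpha>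
    proof -
      obtain C where "C \<in> F" and C: "(T_plus b \<alpha> ^^ i) 0 = A i * \<alpha> - C" using F(2) by blast
      have "b * (T_plus b \<alpha> ^^ i) 0 = b * A i * \<alpha> - b * C" unfolding C by (simp add: algebra_simps)
      then have "(T_plus b \<alpha> ^^ Suc i) 0 = A (Suc i) * \<alpha> - b * C \<or>
          (T_plus b \<alpha> ^^ Suc i) 0 = A (Suc i) * \<alpha> - (b * C + 1)"
        by (simp add: T_plus_def A_Suc distrib_right)
      then show ?thesis using \<open>C \<in> F\<close> by blast
    qed
    then show ?case using F(1) by (intro exI[of _ "(\<lambda>C. b * C) ` F \<union> (\<lambda>C. b * C + 1) ` F"]) blast
  qed
  then obtain F where F: "finite F" "\<And>\<alpha>. \<exists>C\<in>F. (T_plus b \<alpha> ^^ i) 0 = A i * \<alpha> - C" by blast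
  have pos: "0 < A i + 1 / b"
    using \<open>1 < b\<close> by (intro add_nonneg_pos) (auto simp: A_def intro!: sum_nonneg)
  have "{\<alpha>. (T_plus b \<alpha> ^^ i) 0 = crit b \<alpha>} \<subseteq> (\<lambda>C. (C + 1 / b) / (A i + 1 / b)) ` F"
  proof
    fix \<alpha> assume "\<alpha> \<in> {\<alpha>. (T_plus b \<alpha> ^^ i) 0 = crit b \<alpha>}"
    moreover obtain C where "C \<in> F" "(T_plus b \<alpha> ^^ i) 0 = A i * \<alpha> - C" using F(2) by blast
    ultimately have "A i * \<alpha> - C = (1 - \<alpha>) / b" by (simp add: crit_def)
    then have "\<alpha> * (A i + 1 / b) = C + 1 / b" by (simp add: algebra_simps diff_divide_distrib)
    then have "\<alpha> = (C + 1 / b) / (A i + 1 / b)" using pos by (simp only: nonzero_eq_divide_eq less_imp_neq)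
    then show "\<alpha> \<in> (\<lambda>C. (C + 1 / b) / (A i + 1 / b)) ` F" using \<open>C \<in> F\<close> by blast
  qed
  then show ?thesis using F(1) finite_surj by blast
qed

text \<open>The interval is cut off at the least of the finitely many parameters with an early hit;
  a hit found below that is late.\<close>

lemma ex_late_hit:
  assumes "1 < b" "a < c" and range: "\<And>\<alpha>. a < \<alpha> \<Longrightarrow> \<alpha> < c \<Longrightarrow> 0 \<le> \<alpha> \<and> \<alpha> \<le> 2 - b"
  shows "\<exists>\<alpha> i. a < \<alpha> \<and> \<alpha> < c \<and> N \<le> i \<and> (T_plus b \<alpha> ^^ i) 0 = crit b \<alpha> \<and>
    (\<forall>l<i. (T_plus b \<alpha> ^^ l) 0 \<noteq> crit b \<alpha>)"
proof -
  define E where "E = {\<alpha>. a < \<alpha> \<and> \<alpha> < c \<and> (\<exists>i<N. (T_plus b \<alpha> ^^ i) 0 = crit b \<alpha>)}"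
  have "E \<subseteq> (\<Union>i<N. {\<alpha>. (T_plus b \<alpha> ^^ i) 0 = crit b \<alpha>})" by (auto simp: E_def)
  then have "finite E" by (rule finite_subset) (simp add: finite_hit[OF \<open>1 < b\<close>])
  define c' where "c' = Min (insert c E)"
  have c': "a < c'" "c' \<le> c" "\<And>\<alpha>. \<alpha> \<in> E \<Longrightarrow> c' \<le> \<alpha>"
    using \<open>finite E\<close> \<open>a < c\<close> by (auto simp: c'_def E_def)
  obtain \<alpha> i where \<alpha>: "a < \<alpha>" "\<alpha> < c'" "(T_plus b \<alpha> ^^ i) 0 = crit b \<alpha>"
    using ex_hit[OF \<open>1 < b\<close> c'(1)] range c'(2) by force
  define l where "l = (LEAST i. (T_plus b \<alpha> ^^ i) 0 = crit b \<alpha>)"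
  have l: "(T_plus b \<alpha> ^^ l) 0 = crit b \<alpha>" unfolding l_def using \<alpha>(3) by (rule LeastI)
  have "\<forall>i<l. (T_plus b \<alpha> ^^ i) 0 \<noteq> crit b \<alpha>" unfolding l_def using not_less_Least by blast
  moreover have "N \<le> l"
  proof (rule ccontr)
    assume "\<not> N \<le> l"
    then have "\<alpha> \<in> E" using l \<alpha> c'(2) by (auto simp: E_def intro!: exI[of _ l])
    then show False using c'(3) \<alpha>(2) by force
  qed
  ultimately show ?thesis using l \<alpha> c'(2) by (meson less_le_trans)
qed

text \<open>\<open>g\<close> is the orbit of 1 under multiplication by \<open>\<beta>\<close>
  followed by subtraction of 1. It reaches \<open>g m = 0\<close>, and running the recursion
  backwards from there gives positivity.\<close>

lemma multinacci_gap:
  fixes \<beta> :: real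
  assumes "1 < \<beta>" "\<beta> ^ m = (\<Sum>i<m. \<beta> ^ i)" "i < m"
  defines "g \<equiv> \<lambda>i. \<beta> ^ i - (\<Sum>l<i. \<beta> ^ l)"
  shows "0 < g i" "Suc i < m \<Longrightarrow> 1 < \<beta> * g i" "Suc i = m \<Longrightarrow> \<beta> * g i = 1" "g (Suc i) = \<beta> * g i - 1"
proof -
  have step: "g (Suc i) = \<beta> * g i - 1" for i
    unfolding g_def sum.lessThan_Suc_shift by (simp add: sum_distrib_left right_diff_distrib)
  have gm: "g m = 0" using assms by simp
  have "0 < g (m - Suc d)" if "d < m" for d
    using that
  proof (induction d)
    case 0
    then have "\<beta> * g (m - 1) = 1" using step[of "m - 1"] gm by simp
    then show ?case using \<open>1 < \<beta>\<close> by (metis One_nat_def less_trans zero_less_mult_pos zero_less_one)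
  next
    case (Suc d)
    then have "m - Suc d = Suc (m - Suc (Suc d))" by simp
    then have "0 < \<beta> * g (m - Suc (Suc d)) - 1" using Suc step[of "m - Suc (Suc d)"] by simp
    then have "0 < \<beta> * g (m - Suc (Suc d))" by simp
    then show ?case using \<open>1 < \<beta>\<close> by (simp add: zero_less_mult_iff)
  qed
  then have pos: "0 < g i" if "i < m" for i
    using that by (metis Suc_diff_Suc diff_Suc_less diff_diff_cancel gr_implies_not0 less_imp_le_nat not_gr0)
  show "0 < g i" using pos assms by blast
  show "1 < \<beta> * g i" if "Suc i < m" using pos[OF that] step[of i] by simp
  show "\<beta> * g i = 1" if "Suc i = m" using gm step[of i] that by simp
  show "g (Suc i) = \<beta> * g i - 1" by (rule step)
qed

context renormalizable
begin

text \<open>The gap between the two orbits follows the expansion of \<open>1\<close> in base \<open>b ^ n\<close>, so it vanishes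
  after \<open>m\<close> steps, unless in the last step both points lie on the same side of the critical point;
  then they return to the endpoints.\<close>

lemma matching:
  assumes m: "0 < m" "(b ^ n) ^ m = (\<Sum>i<m. (b ^ n) ^ i)"
  shows "((T_plus b \<alpha> ^^ n) ^^ m) u = ((T_minus b \<alpha> ^^ n) ^^ m) v \<or> ((T_plus b \<alpha> ^^ n) ^^ m) u = u"
proof -
  define \<beta> where "\<beta> = b ^ n"
  define L where "L = v - u"
  define g where "g i = \<beta> ^ i - (\<Sum>l<i. \<beta> ^ l)" for i :: nat
  define X where "X i = ((T_plus b \<alpha> ^^ n) ^^ i) u" for i
  define Y where "Y i = ((T_minus b \<alpha> ^^ n) ^^ i) v" for i
  have \<beta>: "1 < \<beta>" using b n by (simp add: \<beta>_def one_less_power)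
  have "0 < L" using u_less_p p_less_v by (simp add: L_def)
  have eq: "\<beta> ^ m = (\<Sum>i<m. \<beta> ^ i)" using m by (simp add: \<beta>_def)
  note g = multinacci_gap[OF \<beta> eq, folded g_def]
  have uv: "u \<in> {u..v}" "v \<in> {u..v}" using u_less_p p_less_v by auto
  have X_mem: "X i \<in> {u..v}" and Y_mem: "Y i \<in> {u..v}" for i
    unfolding X_def Y_def by (rule renormalized_funpow_mem uv)+
  have X_step: "X (Suc i) = (if X i < p then v - \<beta> * (p - X i) else u + \<beta> * (X i - p))" for i
    using renormalized_plus[OF X_mem[of i]] by (simp add: X_def \<beta>_def)
  have Y_step: "Y (Suc i) = (if Y i \<le> p then v - \<beta> * (p - Y i) else u + \<beta> * (Y i - p))" for i
    using renormalized_minus[OF Y_mem[of i]] by (simp add: Y_def \<beta>_def)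
  have same: "Y (Suc i) - X (Suc i) = \<beta> * (Y i - X i)" if "X i < p \<longleftrightarrow> Y i \<le> p" for i
    using that X_step[of i] Y_step[of i] by (auto simp: algebra_simps)
  have split: "Y (Suc i) - X (Suc i) = \<beta> * (Y i - X i) - L" if "X i < p" "p < Y i" for i
    using that X_step[of i] Y_step[of i] by (auto simp: algebra_simps L_def)
  have diff_le: "Y i - X i \<le> L" for i using X_mem[of i] Y_mem[of i] by (auto simp: L_def)
  have gap: "Y i - X i = L * g i" if "i < m" for i
    using that
  proof (induction i)
    case 0
    then show ?case by (simp add: X_def Y_def L_def g_def)
  next
    case (Suc i)
    then have IH: "Y i - X i = L * g i" "0 < g i" "1 < \<beta> * g i" using g by auto
    have "0 < L * g i" using IH \<open>0 < L\<close> by simp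
    then have "X i < Y i" using IH by simp
    have "L * 1 < L * (\<beta> * g i)" using IH \<open>0 < L\<close> by (intro mult_strict_left_mono)
    \<comment> \<open>On the same side the next distance would exceed the length of
      \<open>[u, v]\<close>, so \<open>p\<close> separates the two points.\<close>
    then have big: "L < \<beta> * (Y i - X i)" using IH by (simp add: mult.left_commute)
    then have "\<not> (X i < p \<longleftrightarrow> Y i \<le> p)" using same[of i] diff_le[of "Suc i"] by force
    then have "X i < p" "p < Y i" using \<open>X i < Y i\<close> by auto
    then have "Y (Suc i) - X (Suc i) = \<beta> * (L * g i) - L" using split[of i] IH by simp
    also have "\<dots> = L * (\<beta> * g i - 1)" by (simp add: algebra_simps)
    also have "\<dots> = L * g (Suc i)" using g(4)[of i] Suc.prems by simp
    finally show ?case .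
  qed
  obtain i where i: "Suc i = m" using m(1) by (cases m) auto
  then have gi: "Y i - X i = L * g i" "0 < g i" "\<beta> * g i = 1" using gap[of i] g by auto
  have "0 < L * g i" using gi \<open>0 < L\<close> by simp
  then have "X i < Y i" using gi by simp
  have bL: "\<beta> * (Y i - X i) = L" using gi by (simp add: mult.left_commute)
  have "X m = Y m \<or> X m = u"
  proof (cases "X i < p \<longleftrightarrow> Y i \<le> p")
    case True
    \<comment> \<open>Points of \<open>[u, v]\<close> at distance \<open>L\<close> are its
      endpoints, which forces \<open>X m = u\<close>.\<close>
    then have "Y m - X m = L" using same bL i by auto
    then show ?thesis using X_mem[of m] Y_mem[of m] by (auto simp: L_def)
  next
    case False
    then have "X i < p" "p < Y i" using \<open>X i < Y i\<close> by auto
    then have "Y (Suc i) - X (Suc i) = 0" using split[of i] bL by simp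
    then show ?thesis using i by simp
  qed
  then show ?thesis by (simp add: X_def Y_def)
qed

text \<open>A return to \<open>u\<close> would let the hit occur \<open>n * m\<close> steps earlier,
  although it is the first one. So the orbits have merged before the hit; they stay together up to
  it because the two maps differ only at \<open>p\<close>.\<close>

lemma periodic_of_late_hit:
  assumes m: "0 < m" "(b ^ n) ^ m = (\<Sum>i<m. (b ^ n) ^ i)"
    and late: "n + n * m \<le> l" and hit: "(T_plus b \<alpha> ^^ l) 0 = p"
    and first: "\<forall>i<l. (T_plus b \<alpha> ^^ i) 0 \<noteq> p"
  shows "(T_plus b \<alpha> ^^ Suc l) p = p" "(T_minus b \<alpha> ^^ Suc l) p = p"
proof -
  let ?P = "T_plus b \<alpha>" and ?M = "T_minus b \<alpha>"
  define a where "a = n - 1"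
  have a: "Suc a = n" using n by (simp add: a_def)
  have u: "(?P ^^ a) 0 = u" and v: "(?M ^^ a) 1 = v"
    using funpow_crit unfolding a[symmetric] funpow_Suc_right o_apply T_crit by auto
  have P: "(?P ^^ (n * m + a)) 0 = ((?P ^^ n) ^^ m) u" and M: "(?M ^^ (n * m + a)) 1 = ((?M ^^ n) ^^ m) v"
    using u v by (auto simp: funpow_add funpow_mult)
  obtain e where e: "l = e + (n * m + a)"
    using late a le_Suc_ex[of "n * m + a" l] by (auto simp: add.commute)
  have split_P: "(?P ^^ (i + (n * m + a))) 0 = (?P ^^ i) ((?P ^^ (n * m + a)) 0)" for i
    by (simp only: funpow_add o_apply)
  have "((?P ^^ n) ^^ m) u \<noteq> u"
  proof
    assume "((?P ^^ n) ^^ m) u = u"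
    then have "(?P ^^ l) 0 = (?P ^^ e) u" unfolding e split_P P by simp
    also have "\<dots> = (?P ^^ (e + a)) 0" using u by (simp add: funpow_add)
    finally have "(?P ^^ (e + a)) 0 = p" using hit by simp
    moreover have "e + a < l" using e n m by simp
    ultimately show False using first by blast
  qed
  then have match: "((?P ^^ n) ^^ m) u = ((?M ^^ n) ^^ m) v" using matching[OF m] by blast
  define z where "z = ((?P ^^ n) ^^ m) u"
  have Pz: "(?P ^^ (i + (n * m + a))) 0 = (?P ^^ i) z" for i unfolding split_P P z_def ..
  have "(?M ^^ i) z = (?P ^^ i) z" if "i \<le> e" for i
    using that
  proof (induction i)
    case (Suc i)
    have "(?P ^^ i) z \<noteq> p" using first Suc.prems e Pz[of i] by (metis add_less_cancel_right Suc_le_eq)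
    then have "?M ((?P ^^ i) z) = ?P ((?P ^^ i) z)" by (auto simp: T_plus_def T_minus_def)
    then show ?case using Suc by simp
  qed simp
  then have "(?M ^^ e) z = p" using hit Pz[of e] e by simp
  moreover have "(?M ^^ l) 1 = (?M ^^ e) z"
    unfolding e z_def match M[symmetric] by (simp only: funpow_add o_apply)
  ultimately show "(?M ^^ Suc l) p = p" unfolding funpow_Suc_right o_apply T_crit by simp
  show "(?P ^^ Suc l) p = p" unfolding funpow_Suc_right o_apply T_crit by (rule hit)
qed

end

section \<open>Orbits for Pisot slopes\<close>

definition rpoly :: "rat poly \<Rightarrow> complex \<Rightarrow> complex" where
  "rpoly f z = poly (map_poly of_rat f) z"

lemma rpoly_0 [simp]: "rpoly 0 z = 0"
  by (simp add: rpoly_def)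

lemma rpoly_pCons [simp]: "rpoly (pCons a f) z = of_rat a + z * rpoly f z"
  by (simp add: rpoly_def map_poly_pCons)

lemma rpoly_add [simp]: "rpoly (f + g) z = rpoly f z + rpoly g z"
proof (induction f arbitrary: g)
  case (pCons a f)
  then show ?case by (cases g) (simp add: of_rat_add algebra_simps)
qed simp

lemma rpoly_smult [simp]: "rpoly (smult c f) z = of_rat c * rpoly f z"
  by (induction f) (simp_all add: of_rat_mult algebra_simps)

lemma rpoly_mult [simp]: "rpoly (f * g) z = rpoly f z * rpoly g z"
  by (induction f) (simp_all add: algebra_simps)

lemma rpoly_diff [simp]: "rpoly (f - g) z = rpoly f z - rpoly g z"
  using rpoly_add[of "f - g" g z] by (simp add: algebra_simps)

lemma rpoly_mod:
  assumes "rpoly f z = 0"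
  shows "rpoly (g mod f) z = rpoly g z"
  using rpoly_add[of "g div f * f" "g mod f" z] assms by simp

text \<open>Interpolation with bounds: splitting off a node \<open>z\<close> by synthetic division
  leaves a quotient with one coefficient less, whose value at another node \<open>w\<close> is the
  difference quotient of \<open>r\<close> and hence bounded.\<close>

lemma coeff_bound_from_values:
  fixes G :: "complex set"
  assumes "finite G"
  shows "\<exists>K. \<forall>r. (\<forall>j\<ge>card G. coeff r j = 0) \<and> (\<forall>z\<in>G. cmod (poly r z) \<le> B z) \<longrightarrow>
    (\<forall>j. cmod (coeff r j) \<le> K)"
  using assms
proof (induction G arbitrary: B)
  case empty
  show ?case by (intro exI[of _ 0]) simp
next
  case (insert z G)
  define B' where "B' w = (B w + B z) / cmod (w - z)" for w
  from insert.IH[of B'] obtain K where K: "\<And>r j. \<forall>j\<ge>card G. coeff r j = 0 \<Longrightarrow>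
      \<forall>w\<in>G. cmod (poly r w) \<le> B' w \<Longrightarrow> cmod (coeff r j) \<le> K" by blast
  have "cmod (coeff r j) \<le> B z + cmod z * K + K"
    if r: "\<forall>j\<ge>card (insert z G). coeff r j = 0" "\<forall>w\<in>insert z G. cmod (poly r w) \<le> B w" for r j
  proof -
    define q where "q = synthetic_div r z"
    have r_eq: "r = [:- z, 1:] * q + [:poly r z:]"
      unfolding q_def by (rule synthetic_div_correct'[symmetric])
    have "degree r \<le> card G" using r(1) insert by (intro degree_le) auto
    then have "coeff q j = 0" if "j \<ge> card G" for j
    proof (cases "degree r = 0")
      case True
      then have "q = 0" by (simp add: q_def synthetic_div_eq_0_iff)
      then show ?thesis by simp
    next
      case False
      then have "degree q < j" using \<open>degree r \<le> card G\<close> that by (simp add: q_def degree_synthetic_div)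
      then show ?thesis by (rule coeff_eq_0)
    qed
    moreover have "cmod (poly q w) \<le> B' w" if "w \<in> G" for w
    proof -
      have "w \<noteq> z" using that insert by auto
      have "poly r w = (w - z) * poly q w + poly r z"
        using arg_cong[OF r_eq, of "\<lambda>f. poly f w"] by (simp add: algebra_simps)
      then have "cmod (w - z) * cmod (poly q w) = cmod (poly r w - poly r z)"
        by (simp add: norm_mult[symmetric])
      also have "\<dots> \<le> cmod (poly r w) + cmod (poly r z)" by (rule norm_triangle_ineq4)
      also have "\<dots> \<le> B w + B z" using r(2) that by (intro add_mono) auto
      finally show ?thesis using \<open>w \<noteq> z\<close> by (simp add: B'_def field_simps)
    qed
    ultimately have q: "cmod (coeff q j) \<le> K" for j using K by blast
    have "0 \<le> K" using q[of 0] norm_ge_zero order_trans by blast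
    have Bz: "cmod (poly r z) \<le> B z" using r(2) by simp
    then have "0 \<le> B z" using norm_ge_zero order_trans by blast
    have "coeff r j = - z * coeff q j + coeff (pCons 0 q) j + coeff [:poly r z:] j"
      by (subst r_eq) simp
    then have "cmod (coeff r j) = cmod (- z * coeff q j + coeff (pCons 0 q) j + coeff [:poly r z:] j)"
      by (rule arg_cong)
    also have "\<dots> \<le> cmod (- z * coeff q j) + cmod (coeff (pCons 0 q) j) + cmod (coeff [:poly r z:] j)"
      by (intro norm_triangle_le add_right_mono norm_triangle_ineq)
    finally have "cmod (coeff r j) \<le> \<dots>" .
    moreover have "cmod (- z * coeff q j) \<le> cmod z * K"
      using q by (simp add: norm_mult mult_left_mono)
    moreover have "cmod (coeff (pCons 0 q) j) \<le> K" using q \<open>0 \<le> K\<close> by (cases j) auto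
    moreover have "cmod (coeff [:poly r z:] j) \<le> B z" using Bz \<open>0 \<le> B z\<close> by (cases j) auto
    ultimately show ?thesis by linarith
  qed
  then show ?case by blast
qed

section \<open>Minimal polynomials and conjugates\<close>

lemma minimal_polynomial:
  assumes "g \<noteq> 0" "rpoly g z = 0"
  obtains f where "lead_coeff f = 1" "irreducible f" "rpoly f z = 0"
    "\<And>h. rpoly h z = 0 \<Longrightarrow> f dvd h"
proof -
  define d where "d = (LEAST d. \<exists>f. f \<noteq> 0 \<and> rpoly f z = 0 \<and> degree f = d)"
  have "\<exists>f. f \<noteq> 0 \<and> rpoly f z = 0 \<and> degree f = d"
    unfolding d_def by (rule LeastI_ex) (use assms in blast)
  then obtain f0 where f0: "f0 \<noteq> 0" "rpoly f0 z = 0" "degree f0 = d" by blast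
  have min: "d \<le> degree h" if "h \<noteq> 0" "rpoly h z = 0" for h
    unfolding d_def using that by (intro Least_le) blast
  define f where "f = smult (inverse (lead_coeff f0)) f0"
  have f: "lead_coeff f = 1" "rpoly f z = 0" "degree f = d" "f \<noteq> 0"
    using f0 by (auto simp: f_def)
  have dvd: "f dvd h" if "rpoly h z = 0" for h
  proof (rule ccontr)
    assume "\<not> f dvd h"
    then have "h mod f \<noteq> 0" by (simp add: dvd_eq_mod_eq_0)
    moreover have "rpoly (h mod f) z = 0" using rpoly_mod[OF f(2)] that by simp
    ultimately show False using min[of "h mod f"] degree_mod_less[OF f(4), of h] f(3) by auto
  qed
  have "\<not> is_unit f"
  proof
    assume "is_unit f"
    then obtain g where "f * g = 1" by (metis dvdE)
    then have "rpoly f z * rpoly g z = rpoly 1 z" by (metis rpoly_mult)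
    then show False using f by (simp add: rpoly_def)
  qed
  moreover have "is_unit g \<or> is_unit h" if gh: "f = g * h" for g h
  proof -
    have nz: "g \<noteq> 0" "h \<noteq> 0" using f(4) gh by auto
    have deg: "degree f = degree g + degree h" using gh nz by (simp add: degree_mult_eq)
    have "rpoly g z = 0 \<or> rpoly h z = 0" using f(2) gh by simp
    then show ?thesis
    proof
      assume "rpoly g z = 0"
      then have "degree h = 0" using min[OF nz(1)] deg f(3) by simp
      then show ?thesis using nz by (simp add: is_unit_iff_degree)
    next
      assume "rpoly h z = 0"
      then have "degree g = 0" using min[OF nz(2)] deg f(3) by simp
      then show ?thesis using nz by (simp add: is_unit_iff_degree)
    qed
  qed
  ultimately have "irreducible f" using f(4) by (intro irreducibleI)
  then show thesis using that f dvd by blast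
qed

text \<open>A double root would be shared with the derivative and make \<open>f\<close> divide a
  nonzero polynomial of smaller degree. Hence there are as many conjugates as coefficients in a
  remainder modulo \<open>f\<close>, as the interpolation bound requires.\<close>

lemma card_roots_irreducible:
  assumes f: "irreducible f"
  shows "finite {z. rpoly f z = 0}" "card {z. rpoly f z = 0} = degree f"
proof -
  define F :: "complex poly" where "F = map_poly of_rat f"
  have roots: "{z. rpoly f z = 0} = {z. poly F z = 0}" by (simp add: rpoly_def F_def)
  have deg: "degree F = degree f" unfolding F_def by (rule degree_map_poly) simp
  have "f \<noteq> 0" using f by auto
  then have "F \<noteq> 0" by (simp add: F_def map_poly_eq_0_iff)
  have "degree f \<noteq> 0" using f \<open>f \<noteq> 0\<close> by (auto simp: irreducible_def is_unit_iff_degree)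
  then have "pderiv f \<noteq> 0" by (simp add: pderiv_eq_0_iff)
  have "degree (pderiv f) < degree f" using \<open>degree f \<noteq> 0\<close> by (simp add: degree_pderiv)
  then have "\<not> f dvd pderiv f" using \<open>pderiv f \<noteq> 0\<close> by (auto dest: dvd_imp_degree_le)
  have pderivF: "pderiv F = map_poly of_rat (pderiv f)"
    by (rule poly_eqI) (simp add: F_def coeff_pderiv coeff_map_poly of_rat_mult of_rat_add)
  have no_double: "\<not> (poly F z = 0 \<and> poly (pderiv F) z = 0)" for z
  proof
    assume "poly F z = 0 \<and> poly (pderiv F) z = 0"
    then have "rpoly f z = 0" "rpoly (pderiv f) z = 0" 
      unfolding rpoly_def F_def[symmetric] pderivF[symmetric] by auto
    with minimal_polynomial[OF \<open>f \<noteq> 0\<close>, of z] obtain g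
      where "irreducible g" "g dvd f" "g dvd pderiv f" by metis
    then have "f dvd g" using f irreducibleD' irreducible_not_unit by blast
    then have "f dvd pderiv f" using \<open>g dvd pderiv f\<close> dvd_trans by blast
    then show False using \<open>\<not> f dvd pderiv f\<close> by simp
  qed
  have fin: "finite {z. poly F z = 0}" by (rule poly_roots_finite[OF \<open>F \<noteq> 0\<close>])
  then show "finite {z. rpoly f z = 0}" by (simp add: roots)
  have "order z F = 1" if "poly F z = 0" for z
  proof -
    have "rsquarefree F" using no_double by (simp add: rsquarefree_roots)
    then show ?thesis using that \<open>F \<noteq> 0\<close> by (metis order_root rsquarefree_def)
  qed
  then have "size (proots F) = card {z. poly F z = 0}"
    unfolding size_multiset_overloaded_eq using \<open>F \<noteq> 0\<close> by simp
  then show "card {z. rpoly f z = 0} = degree f" by (simp add: roots size_proots_complex deg)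
qed

section \<open>Bounded denominators and finiteness\<close>

lemma common_denominator:
  assumes "finite A"
  shows "\<exists>q::nat. 0 < q \<and> (\<forall>x\<in>A. of_nat q * (x::rat) \<in> \<int>)"
  using assms
proof induction
  case empty
  show ?case by (intro exI[of _ 1]) simp
next
  case (insert x A)
  then obtain q :: nat where q: "0 < q" "\<forall>x\<in>A. of_nat q * x \<in> \<int>" by blast
  obtain a c :: int where ac: "x = of_int a / of_int c" "0 < c"
    by (cases x) (auto simp: Fract_of_int_quotient)
  define c' where "c' = nat c"
  have c': "0 < c'" "x = of_int a / of_nat c'" using ac by (auto simp: c'_def)
  have "of_nat (c' * q) * x \<in> \<int>"
  proof -
    have "of_nat (c' * q) * x = of_int (a * int q)" using c' by simp
    then show ?thesis by (metis Ints_of_int)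
  qed
  moreover have "of_nat (c' * q) * y \<in> \<int>" if "y \<in> A" for y
  proof -
    have "of_nat (c' * q) * y = of_nat c' * (of_nat q * y)" by simp
    also have "of_nat q * y \<in> \<int>" using q that by blast
    then have "of_nat c' * (of_nat q * y) \<in> \<int>" by (rule Ints_mult[OF Ints_of_nat])
    finally show ?thesis .
  qed
  ultimately show ?case using c' q by (intro exI[of _ "c' * q"]) (auto simp del: of_nat_mult)
qed

lemma finite_bounded_denominator:
  assumes "0 < q"
  shows "finite {x::rat. of_nat q * x \<in> \<int> \<and> cmod (of_rat x) \<le> K}" (is "finite ?A")
proof -
  have "?A \<subseteq> (\<lambda>i::int. of_int i / of_nat q) ` {- \<lceil>real q * K\<rceil>..\<lceil>real q * K\<rceil>}"
  proof
    fix x assume x: "x \<in> ?A"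
    then obtain i :: int where i: "of_nat q * x = of_int i" by (auto elim: Ints_cases)
    have "complex_of_real (real_of_int i) = of_rat (of_nat q * x)" unfolding i by simp
    also have "\<dots> = of_nat q * of_rat x" by (simp add: of_rat_mult)
    finally have "\<bar>real_of_int i\<bar> = real q * cmod (of_rat x)"
      by (metis norm_mult norm_of_nat norm_of_real)
    also have "\<dots> \<le> real q * K" using x by (intro mult_left_mono) auto
    finally have "\<bar>real_of_int i\<bar> \<le> real q * K" .
    then have "i \<le> \<lceil>real q * K\<rceil>" "- i \<le> \<lceil>real q * K\<rceil>" by linarith+
    moreover have "x = of_int i / of_nat q" using i assms by (simp add: field_simps flip: i)
    ultimately show "x \<in> (\<lambda>i::int. of_int i / of_nat q) ` {- \<lceil>real q * K\<rceil>..\<lceil>real q * K\<rceil>}" by auto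
  qed
  then show ?thesis by (rule finite_subset) simp
qed

lemma finite_polys:
  fixes A :: "'a::zero set"
  assumes "finite A"
  shows "finite {r. (\<forall>j\<ge>d. coeff r j = 0) \<and> (\<forall>j. coeff r j \<in> A)}" (is "finite ?R")
proof -
  have "?R \<subseteq> Poly ` {xs. set xs \<subseteq> A \<and> length xs = d}"
  proof
    fix r assume r: "r \<in> ?R"
    have "r = Poly (map (coeff r) [0..<d])"
      using r by (intro poly_eqI) (auto simp: nth_default_def)
    moreover have "set (map (coeff r) [0..<d]) \<subseteq> A" using r by auto
    ultimately show "r \<in> Poly ` {xs. set xs \<subseteq> A \<and> length xs = d}" by force
  qed
  then show ?thesis using finite_lists_length_eq[OF assms] by (meson finite_imageI finite_subset)
qed

text \<open>Reduction modulo \<open>f\<close> is linear, so a common denominator for the reduced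
  monomials of degree below \<open>d\<close> serves all integer combinations.\<close>

lemma mod_denominator:
  fixes f :: "rat poly"
  shows "\<exists>q::nat. 0 < q \<and> (\<forall>M j. (\<forall>i. coeff M i \<in> \<int>) \<and> (\<forall>i\<ge>d. coeff M i = 0) \<longrightarrow>
    of_nat q * coeff (M mod f) j \<in> \<int>)"
proof -
  define A where "A = (\<Union>l<d. range (coeff (monom 1 l mod f)))"
  have "finite A"
    unfolding A_def
  proof (rule finite_UN_I)
    show "finite (range (coeff r))" for r :: "rat poly"
    proof -
      have "coeff r j \<in> insert 0 (coeff r ` {..degree r})" for j
        by (cases "j \<le> degree r") (simp_all add: coeff_eq_0)
      then have "range (coeff r) \<subseteq> insert 0 (coeff r ` {..degree r})" by blast
      then show ?thesis by (rule finite_subset) simp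
    qed
  qed simp
  from common_denominator[OF this] obtain q :: nat where q: "0 < q" "\<And>x. x \<in> A \<Longrightarrow> of_nat q * x \<in> \<int>"
    by blast
  have "of_nat q * coeff (M mod f) j \<in> \<int>"
    if M: "\<forall>i. coeff M i \<in> \<int>" "\<forall>i\<ge>d. coeff M i = 0" for M j
  proof -
    have M_eq: "M = (\<Sum>l<d. smult (coeff M l) (monom 1 l))"
      using M(2) by (intro poly_eqI) (auto simp: coeff_sum not_less if_distrib[of "(*) _"] cong: if_cong)
    have "(\<Sum>l<e. smult (coeff M l) (monom 1 l)) mod f = (\<Sum>l<e. smult (coeff M l) (monom 1 l mod f))" for e
      by (induction e) (simp_all add: poly_mod_add_left mod_smult_left)
    then have "M mod f = (\<Sum>l<d. smult (coeff M l) (monom 1 l mod f))"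
      by (subst M_eq)
    then have "of_nat q * coeff (M mod f) j = (\<Sum>l<d. coeff M l * (of_nat q * coeff (monom 1 l mod f) j))"
      by (simp add: coeff_sum sum_distrib_left mult.left_commute)
    also have "\<dots> \<in> \<int>"
    proof (rule Ints_sum)
      fix l assume "l \<in> {..<d}"
      then have "of_nat q * coeff (monom 1 l mod f) j \<in> \<int>" by (intro q(2)) (auto simp: A_def)
      then show "coeff M l * (of_nat q * coeff (monom 1 l mod f) j) \<in> \<int>"
        using M(1) by (intro Ints_mult[of "coeff M l"]) auto
    qed
    finally show ?thesis .
  qed
  then show ?thesis using q(1) by blast
qed

text \<open>The values \<open>s i\<close> are integer polynomials in \<open>\<beta>\<close>, reduced modulo the minimal polynomial: their
  denominators are bounded because \<open>\<beta>\<close> is an algebraic integer, and their coefficients are bounded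
  because the conjugate orbits stay bounded.\<close>

lemma finite_pisot_orbit:
  fixes s :: "nat \<Rightarrow> real" and C :: "nat \<Rightarrow> int"
  assumes "pisot \<beta>" and s0: "s 0 = of_int c0" and step: "\<And>i. s (Suc i) = \<beta> * s i + of_int (C i)"
    and C_le: "\<And>i. \<bar>C i\<bar> \<le> B" and s_le: "\<And>i. \<bar>s i\<bar> \<le> B'"
  shows "finite (range s)"
proof -
  have "algebraic_int \<beta>" and conj: "\<And>z. galois_conjugate (complex_of_real \<beta>) z \<Longrightarrow>
      z \<noteq> complex_of_real \<beta> \<Longrightarrow> cmod z < 1"
    using assms(1) by (auto simp: pisot_def)
  \<comment> \<open>Two polynomials share the work: this monic integral one keeps representatives
    integral and of degree below \<open>d\<close>, while the minimal polynomial \<open>f\<close>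
    supplies the conjugates.\<close>
  then obtain P0 :: "int poly" where P0: "poly (map_poly of_int P0) \<beta> = 0" "lead_coeff P0 = 1"
    by (auto simp: algebraic_int_altdef_ipoly)
  define P :: "rat poly" where "P = map_poly of_int P0"
  define d where "d = degree P"
  have coeffP: "coeff P i = of_int (coeff P0 i)" for i by (simp add: P_def coeff_map_poly)
  have dP: "d = degree P0" unfolding d_def P_def by (rule degree_map_poly) simp
  then have leadP: "coeff P d = 1" using P0 by (simp add: coeffP)
  have "rpoly (map_poly of_int g) (of_real \<beta>) = of_real (poly (map_poly of_int g) \<beta>)" for g :: "int poly"
    by (induction g) (simp_all add: map_poly_pCons)
  then have P_root: "rpoly P (of_real \<beta>) = 0" using P0 by (simp add: P_def)
  have "P \<noteq> 0" using leadP by auto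
  have "0 < d"
  proof (rule ccontr)
    assume "\<not> 0 < d"
    then have "P = [:1:]" using leadP by (metis coeff_pCons_0 d_def degree_0_id degree_eq_zeroE gr0I)
    then show False using P_root by simp
  qed
  obtain f where f: "lead_coeff f = 1" "irreducible f" "rpoly f (of_real \<beta>) = 0"
      "\<And>h. rpoly h (of_real \<beta>) = 0 \<Longrightarrow> f dvd h"
    by (rule minimal_polynomial[OF \<open>P \<noteq> 0\<close> P_root]) blast
  define G where "G = {z. rpoly f z = 0}"
  have G: "finite G" "card G = degree f" unfolding G_def by (rule card_roots_irreducible[OF f(2)])+
  have P_G: "rpoly P z = 0" if "z \<in> G" for z
    using f(4)[OF P_root] that by (auto simp: G_def elim!: dvdE)
  have small: "cmod z < 1" if "z \<in> G" "z \<noteq> of_real \<beta>" for z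
  proof (rule conj[OF _ that(2)])
    show "galois_conjugate (complex_of_real \<beta>) z"
      unfolding galois_conjugate_def using f that by (auto simp: G_def rpoly_def)
  qed
  \<comment> \<open>The conjugate orbit: the same integers \<open>C i\<close>, with \<open>z\<close>
    in place of \<open>\<beta>\<close>.\<close>
  define S where "S z = rec_nat (of_int c0) (\<lambda>i x. z * x + of_int (C i))" for z :: complex
  have S_0: "S z 0 = of_int c0" and S_Suc: "S z (Suc i) = z * S z i + of_int (C i)" for z i
    by (simp_all add: S_def)
  have S_\<beta>: "S (of_real \<beta>) i = of_real (s i)" for i
    by (induction i) (simp_all add: S_0 S_Suc s0 step)
  \<comment> \<open>For \<open>cmod z < 1\<close> this is a geometric series bound, preserved by
    multiplying with \<open>cmod z\<close> and adding \<open>B\<close>.\<close>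
  define bound where "bound z = (if z = of_real \<beta> then B' else \<bar>of_int c0\<bar> + of_int B / (1 - cmod z))" for z
  have "0 \<le> B" using C_le[of 0] by simp
  have S_le: "cmod (S z i) \<le> bound z" if "z \<in> G" for z i
  proof (cases "z = of_real \<beta>")
    case True
    then show ?thesis using s_le by (simp add: bound_def S_\<beta>)
  next
    case False
    then have z: "cmod z < 1" using small that by blast
    show ?thesis
    proof (induction i)
      case 0
      then show ?case using False z \<open>0 \<le> B\<close> by (simp add: bound_def S_0)
    next
      case (Suc i)
      have "cmod (S z (Suc i)) \<le> cmod z * cmod (S z i) + \<bar>of_int (C i)\<bar>"
        unfolding S_Suc using norm_triangle_ineq[of "z * S z i" "of_int (C i)"] by (simp add: norm_mult)
      also have "\<dots> \<le> cmod z * bound z + of_int B"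
        using Suc C_le[of i] by (intro add_mono mult_left_mono) (auto simp flip: of_int_abs)
      also have "of_int B \<le> (1 - cmod z) * bound z"
        using False z by (simp add: bound_def distrib_left)
      also have "cmod z * bound z + (1 - cmod z) * bound z = bound z" by (simp add: algebra_simps)
      finally show ?case by simp
    qed
  qed
  have "\<exists>M. (\<forall>j. coeff M j \<in> \<int>) \<and> (\<forall>j\<ge>d. coeff M j = 0) \<and> (\<forall>z\<in>G. rpoly M z = S z i)" for i
  proof (induction i)
    case 0
    show ?case using \<open>0 < d\<close>
      by (intro exI[of _ "[:of_int c0:]"]) (auto simp: S_0 coeff_pCons split: nat.splits)
  next
    case (Suc i)
    then obtain M where M: "\<And>j. coeff M j \<in> \<int>" "\<And>j. d \<le> j \<Longrightarrow> coeff M j = 0"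
        "\<And>z. z \<in> G \<Longrightarrow> rpoly M z = S z i" by blast
    \<comment> \<open>Subtracting a multiple of the monic \<open>P\<close> cancels the coefficient
      at \<open>d\<close>, keeps integrality and leaves the values on \<open>G\<close>
      unchanged.\<close>
    define M' where "M' = pCons (of_int (C i)) M - smult (coeff M (d - 1)) P"
    have "coeff M' j \<in> \<int>" for j
      unfolding M'_def coeff_diff coeff_smult coeffP
      using M(1) by (intro Ints_diff Ints_mult) (auto simp: coeff_pCons split: nat.splits)
    moreover have "coeff M' j = 0" if "d \<le> j" for j
    proof (cases "j = d")
      case True
      then show ?thesis using leadP \<open>0 < d\<close> by (cases d) (auto simp: M'_def)
    next
      case False
      then have "coeff P j = 0" "0 < j" using that by (auto simp: d_def intro: coeff_eq_0)
      then show ?thesis using False that M(2) by (cases j) (auto simp: M'_def)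
    qed
    moreover have "rpoly M' z = S z (Suc i)" if "z \<in> G" for z
      using M(3)[OF that] P_G[OF that] by (simp add: M'_def S_Suc)
    ultimately show ?case by blast
  qed
  then obtain M where M: "\<And>i. (\<forall>j. coeff (M i) j \<in> \<int>) \<and> (\<forall>j\<ge>d. coeff (M i) j = 0) \<and>
      (\<forall>z\<in>G. rpoly (M i) z = S z i)" by metis
  obtain q :: nat where q: "0 < q" "\<And>N j. (\<forall>i. coeff N i \<in> \<int>) \<and> (\<forall>i\<ge>d. coeff N i = 0) \<Longrightarrow>
      of_nat q * coeff (N mod f) j \<in> \<int>"
    using mod_denominator[of d f] by blast
  obtain K where K: "\<And>r j. (\<forall>j\<ge>card G. coeff r j = 0) \<and> (\<forall>z\<in>G. cmod (poly r z) \<le> bound z) \<Longrightarrow>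
      cmod (coeff r j) \<le> K"
    using coeff_bound_from_values[OF G(1), of bound] by blast
  \<comment> \<open>No bound is known for the integral representatives themselves; their remainders
    are controlled by the values at all conjugates.\<close>
  define r where "r i = M i mod f" for i
  have "f \<noteq> 0" using f(1) by auto
  have "degree f \<noteq> 0" using f(2) \<open>f \<noteq> 0\<close> by (auto simp: irreducible_def is_unit_iff_degree)
  have r_deg: "coeff (r i) j = 0" if "degree f \<le> j" for i j
    using degree_mod_less'[of f "M i"] \<open>f \<noteq> 0\<close> \<open>degree f \<noteq> 0\<close> that
    by (cases "r i = 0") (auto simp: r_def intro!: coeff_eq_0)
  have r_val: "rpoly (r i) z = S z i" if "z \<in> G" for i z
    using M that rpoly_mod[of f z] by (simp add: r_def G_def)
  define A where "A = {x::rat. of_nat q * x \<in> \<int> \<and> cmod (of_rat x) \<le> K}"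
  have "finite A" unfolding A_def by (rule finite_bounded_denominator[OF q(1)])
  have "coeff (r i) j \<in> A" for i j
  proof -
    have "cmod (coeff (map_poly of_rat (r i)) j) \<le> K"
      using r_deg r_val S_le by (intro K) (auto simp: coeff_map_poly G rpoly_def)
    then show ?thesis using q(2) M by (simp add: A_def r_def coeff_map_poly)
  qed
  then have "range r \<subseteq> {r. (\<forall>j\<ge>degree f. coeff r j = 0) \<and> (\<forall>j. coeff r j \<in> A)}"
    using r_deg by auto
  then have "finite (range r)" using finite_polys[OF \<open>finite A\<close>] finite_subset by blast
  moreover have "s i = Re (rpoly (r i) (of_real \<beta>))" for i
    using r_val[of "of_real \<beta>" i] f(3) S_\<beta>[of i] by (simp add: G_def)
  then have "range s = (\<lambda>r. Re (rpoly r (of_real \<beta>))) ` range r" by (auto simp: image_image)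
  ultimately show ?thesis by simp
qed

section \<open>Density\<close>

context renormalizable
begin

text \<open>In the coordinate \<open>t = (z - u) / (v - u)\<close> the two branches are
  \<open>b ^ n * t + \<tau>\<close> and \<open>b ^ n * t + \<tau> - 1\<close>, where
  \<open>\<tau>\<close> is the number assumed rational. Scaling by its denominator makes the
  translations integers.\<close>

lemma finite_renormalized_orbit:
  assumes "pisot (b ^ n)" and rational: "1 - b ^ n * (p - u) / (v - u) \<in> \<rat>"
    and X: "X 0 \<in> {u, v}" "\<And>i. X i \<in> {u..v}"
      "\<And>i. X (Suc i) \<in> {v - b ^ n * (p - X i), u + b ^ n * (X i - p)}"
  shows "finite (range X)"
proof -
  define L where "L = v - u"
  have "0 < L" using u_less_p p_less_v by (simp add: L_def)
  have v: "v = u + L" by (simp add: L_def)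
  from rational obtain a q :: int where aq: "1 - b ^ n * (p - u) / L = of_int a / of_int q" "0 < q"
    unfolding L_def by (metis Rats_cases' of_int_0_less_iff)
  define s where "s i = of_int q * ((X i - u) / L)" for i
  have left: "of_int q * ((v - b ^ n * (p - z) - u) / L) = b ^ n * (of_int q * ((z - u) / L)) + of_int a" for z
  proof -
    have "(v - b ^ n * (p - z) - u) / L = b ^ n * ((z - u) / L) + (1 - b ^ n * (p - u) / L)"
      unfolding v using \<open>0 < L\<close> by (simp add: field_simps)
    then show ?thesis unfolding aq(1) using aq(2) by (simp add: distrib_left)
  qed
  have right: "of_int q * ((u + b ^ n * (z - p) - u) / L) = b ^ n * (of_int q * ((z - u) / L)) + of_int (a - q)" for z
  proof -
    have "(u + b ^ n * (z - p) - u) / L = b ^ n * ((z - u) / L) + (1 - b ^ n * (p - u) / L) - 1"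
      using \<open>0 < L\<close> by (simp add: field_simps)
    then show ?thesis unfolding aq(1) using aq(2) by (simp add: distrib_left right_diff_distrib)
  qed
  have "\<exists>C. C \<in> {a, a - q} \<and> s (Suc i) = b ^ n * s i + of_int C" for i
  proof -
    consider "X (Suc i) = v - b ^ n * (p - X i)" | "X (Suc i) = u + b ^ n * (X i - p)"
      using X(3)[of i] by auto
    then show ?thesis
    proof cases
      case 1
      then have "s (Suc i) = b ^ n * s i + of_int a" by (simp only: s_def left)
      then show ?thesis by blast
    next
      case 2
      then have "s (Suc i) = b ^ n * s i + of_int (a - q)" by (simp only: s_def right)
      then show ?thesis by blast
    qed
  qed
  then obtain C where C: "\<And>i. C i \<in> {a, a - q}" "\<And>i. s (Suc i) = b ^ n * s i + of_int (C i)" by metis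
  have "finite (range s)"
  proof (rule finite_pisot_orbit[where s = s and C = C, OF assms(1) _ C(2)])
    \<comment> \<open>The orbit starts at \<open>t = 0\<close> or \<open>t = 1\<close>.\<close>
    show "s 0 = of_int (if X 0 = u then 0 else q)"
      using X(1) \<open>0 < L\<close> by (auto simp: s_def L_def)
    show "\<bar>C i\<bar> \<le> \<bar>a\<bar> + q" for i using C(1)[of i] aq(2) by auto
    show "\<bar>s i\<bar> \<le> of_int q" for i
    proof -
      define t where "t = (X i - u) / L"
      have "0 \<le> t" "t \<le> 1" using X(2)[of i] \<open>0 < L\<close> by (auto simp: t_def L_def)
      then show ?thesis unfolding s_def t_def[symmetric] using aq(2) by (simp add: abs_mult mult_left_le)
    qed
  qed
  moreover have "X i = u + s i / of_int q * L" for i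
    using \<open>0 < L\<close> aq(2) by (simp add: s_def)
  then have "range X = (\<lambda>t. u + t / of_int q * L) ` range s" by (simp add: image_image)
  ultimately show ?thesis by simp
qed

lemma sofic_of_rational:
  assumes "pisot (b ^ n)" and "1 - b ^ n * (p - u) / (v - u) \<in> \<rat>"
  shows "sofic {0, 1} (\<Omega> b \<alpha>)"
proof -
  let ?P = "T_plus b \<alpha>" and ?M = "T_minus b \<alpha>"
  have uv: "u \<in> {u..v}" "v \<in> {u..v}" using u_less_p p_less_v by auto
  have repeat: "\<exists>i j. i < j \<and> X i = X j" if "finite (range X)" for X :: "nat \<Rightarrow> real"
  proof -
    have "\<not> inj X" using that range_inj_infinite by blast
    then show ?thesis unfolding inj_def by (metis linorder_neqE_nat)
  qed
  have "finite (range (\<lambda>i. ((?P ^^ n) ^^ i) u))"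
    by (rule finite_renormalized_orbit[OF assms])
      (use renormalized_funpow_mem[OF uv(1)] in \<open>auto simp: renormalized_plus\<close>)
  then obtain i' j' where P: "i' < j'" "((?P ^^ n) ^^ i') u = ((?P ^^ n) ^^ j') u"
    using repeat by blast
  have "finite (range (\<lambda>i. ((?M ^^ n) ^^ i) v))"
    by (rule finite_renormalized_orbit[OF assms])
      (use renormalized_funpow_mem[OF uv(2)] in \<open>auto simp: renormalized_minus\<close>)
  then obtain i j where M: "i < j" "((?M ^^ n) ^^ i) v = ((?M ^^ n) ^^ j) v"
    using repeat by blast
  have Pu: "((?P ^^ n) ^^ i) u = (?P ^^ (n * i + n)) p" and Mv: "((?M ^^ n) ^^ i) v = (?M ^^ (n * i + n)) p" for i
    using funpow_crit by (simp_all add: funpow_mult funpow_add)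
  show ?thesis
  proof (rule \<Omega>_sofic)
    show "(?M ^^ (n * i + n)) p = (?M ^^ (n * j + n)) p" using M(2) unfolding Mv .
    show "(?P ^^ (n * i' + n)) p = (?P ^^ (n * j' + n)) p" using P(2) unfolding Pu .
  qed (use b \<alpha>_pos \<alpha>_less M(1) P(1) n in auto)
qed

end

lemma ex_dense_in_param_interval:
  assumes "2 \<le> n" "k < n" "gcd n k = 1" "1 < b" "b ^ n < 2"
    and ex: "\<And>a c. a < c \<Longrightarrow> (\<And>\<alpha>. a < \<alpha> \<Longrightarrow> \<alpha> < c \<Longrightarrow> renormalizable n k b \<alpha>) \<Longrightarrow>
      \<exists>\<alpha>. a < \<alpha> \<and> \<alpha> < c \<and> P \<alpha>"
  shows "\<exists>D. dense_subset D (param_interval n k b) \<and> (\<forall>\<alpha>\<in>D. P \<alpha>)"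
proof -
  have k: "0 < k" "coprime n k" using assms by (auto intro: gr0I simp: coprime_iff_gcd_eq_1)
  define A where "A = (1 + b * (rot_sum n k b - 1)) / (b * (\<Sum>i<n. b ^ i))"
  define B where "B = (b * rot_sum n k b - b ^ (n + 1) + b ^ n + b - 1) / (b * (\<Sum>i<n. b ^ i))"
  have "A < B" unfolding A_def B_def using assms by (intro interval_nonempty) auto
  moreover have "param_interval n k b = {A..B}"
    unfolding A_def B_def using assms k by (intro param_interval_eq) auto
  moreover have "renormalizable n k b \<alpha>" if "A < \<alpha>" "\<alpha> < B" for \<alpha>
    using that assms k unfolding A_def B_def by (intro renormalizable_interior) auto
  ultimately show ?thesis
    using dense_subset_interval[of A B P] ex by (intro exI[of _ "{t. A < t \<and> t < B \<and> P t}"]) force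
qed

theorem corollary1p4:
  fixes m n k :: nat
  assumes "2 \<le> m" and "2 \<le> n" and "k < n" and "gcd n k = 1"
  shows "(\<exists>D. dense_subset D (param_interval n k (root n (multinacci m))) \<and>
            (\<forall>\<alpha>\<in>D. subshift_of_finite_type {0, 1} (\<Omega> (root n (multinacci m)) \<alpha>))) \<and>
         (\<forall>\<beta>::real. 1 < \<beta> \<and> \<beta> < 2 \<and> pisot \<beta> \<longrightarrow>
            (\<exists>D. dense_subset D (param_interval n k (root n \<beta>)) \<and>
               (\<forall>\<alpha>\<in>D. sofic {0, 1} (\<Omega> (root n \<beta>) \<alpha>))))"
proof (intro conjI allI impI)
  define b where "b = root n (multinacci m)"
  have bn: "b ^ n = multinacci m" and "1 < b"
    using multinacci[OF assms(1)] assms by (simp_all add: b_def)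
  show "\<exists>D. dense_subset D (param_interval n k (root n (multinacci m))) \<and>
      (\<forall>\<alpha>\<in>D. subshift_of_finite_type {0, 1} (\<Omega> (root n (multinacci m)) \<alpha>))"
    unfolding b_def[symmetric]
  proof (rule ex_dense_in_param_interval[OF assms(2-4) \<open>1 < b\<close>])
    show "b ^ n < 2" using multinacci[OF assms(1)] bn by simp
    fix a c :: real
    assume "a < c" and R: "\<And>\<alpha>. a < \<alpha> \<Longrightarrow> \<alpha> < c \<Longrightarrow> renormalizable n k b \<alpha>"
    have range: "0 \<le> \<alpha> \<and> \<alpha> \<le> 2 - b" if "a < \<alpha>" "\<alpha> < c" for \<alpha>
      using renormalizable.\<alpha>_pos[OF R[OF that]] renormalizable.\<alpha>_less[OF R[OF that]] by simp
    \<comment> \<open>It takes \<open>n - 1\<close> steps from 0 and 1 to \<open>u\<close> and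
      \<open>v\<close>, and \<open>n * m\<close> more to merge.\<close>
    obtain \<alpha> l where \<alpha>: "a < \<alpha>" "\<alpha> < c" and hit: "n + n * m \<le> l"
        "(T_plus b \<alpha> ^^ l) 0 = crit b \<alpha>" "\<forall>i<l. (T_plus b \<alpha> ^^ i) 0 \<noteq> crit b \<alpha>"
      using ex_late_hit[OF \<open>1 < b\<close> \<open>a < c\<close> range, of "n + n * m"] by blast
    interpret renormalizable n k b \<alpha> using R \<alpha> by blast
    have "(b ^ n) ^ m = (\<Sum>i<m. (b ^ n) ^ i)" using multinacci[OF assms(1)] bn by simp
    then have "(T_plus b \<alpha> ^^ Suc l) p = p" "(T_minus b \<alpha> ^^ Suc l) p = p"
      using hit assms(1) by (auto intro!: periodic_of_late_hit[of m] simp del: funpow.simps)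
    then have "subshift_of_finite_type {0, 1} (\<Omega> b \<alpha>)"
      using \<open>1 < b\<close> range[OF \<alpha>] by (intro \<Omega>_finite_type[of b \<alpha> "Suc l"]) auto
    then show "\<exists>\<alpha>. a < \<alpha> \<and> \<alpha> < c \<and> subshift_of_finite_type {0, 1} (\<Omega> b \<alpha>)" using \<alpha> by blast
  qed
next
  fix \<beta> :: real
  assume \<beta>: "1 < \<beta> \<and> \<beta> < 2 \<and> pisot \<beta>"
  define b where "b = root n \<beta>"
  have bn: "b ^ n = \<beta>" and "1 < b" using \<beta> assms by (simp_all add: b_def)
  show "\<exists>D. dense_subset D (param_interval n k (root n \<beta>)) \<and>
      (\<forall>\<alpha>\<in>D. sofic {0, 1} (\<Omega> (root n \<beta>) \<alpha>))"
    unfolding b_def[symmetric]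
  proof (rule ex_dense_in_param_interval[OF assms(2-4) \<open>1 < b\<close>])
    show "b ^ n < 2" using \<beta> bn by simp
    fix a c :: real
    assume "a < c" and R: "\<And>\<alpha>. a < \<alpha> \<Longrightarrow> \<alpha> < c \<Longrightarrow> renormalizable n k b \<alpha>"
    define D where "D = (\<Sum>i<n. b ^ i)"
    define e where "e = 1 - 1 / b"
    have "0 < D" unfolding D_def using \<open>1 < b\<close> assms by (intro sum_pos) (auto simp: lessThan_empty_iff)
    have "0 < e" using \<open>1 < b\<close> by (simp add: e_def)
    \<comment> \<open>The quantity \<open>(\<alpha> * D - rot_sum n k b) / e\<close> increases with
      \<open>\<alpha>\<close>. A rational value \<open>r\<close> is prescribed and solved for
      \<open>\<alpha>\<close>; the translation part then equals \<open>1 + r\<close>.\<close>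
    have "(a * D - rot_sum n k b) / e < (c * D - rot_sum n k b) / e"
      using \<open>a < c\<close> \<open>0 < D\<close> \<open>0 < e\<close> by (intro divide_strict_right_mono) auto
    then obtain r where r: "r \<in> \<rat>" "(a * D - rot_sum n k b) / e < r" "r < (c * D - rot_sum n k b) / e"
      using Rats_dense_in_real by blast
    define \<alpha> where "\<alpha> = (r * e + rot_sum n k b) / D"
    have "a * D < r * e + rot_sum n k b" "r * e + rot_sum n k b < c * D"
      using r \<open>0 < e\<close> by (simp_all add: field_simps)
    then have \<alpha>: "a < \<alpha>" "\<alpha> < c" using \<open>0 < D\<close> by (simp_all add: \<alpha>_def field_simps)
    interpret renormalizable n k b \<alpha> using R \<alpha> by blast
    have "\<alpha> * D = r * e + rot_sum n k b" using \<open>0 < D\<close> by (simp add: \<alpha>_def)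
    moreover have "b * u + \<alpha> = 1 + \<alpha> * D - rot_sum n k b"
      using lo_last[OF k, of b \<alpha>] by (simp add: u_def D_def)
    ultimately have pu: "b * (p - u) = - (r * e)" by (simp add: right_diff_distrib bp)
    have "b ^ n * (p - u) / (v - u) = b ^ n * (b * (p - u)) / (b * (v - u))"
      using \<open>1 < b\<close> by simp
    also have "\<dots> = - r"
      unfolding pu v_eq using \<open>0 < e\<close> \<open>1 < b\<close> by (simp add: c_def e_def[symmetric])
    finally have "1 - b ^ n * (p - u) / (v - u) \<in> \<rat>" using r(1) by simp
    then have "sofic {0, 1} (\<Omega> b \<alpha>)" using \<beta> bn by (intro sofic_of_rational) auto
    then show "\<exists>\<alpha>. a < \<alpha> \<and> \<alpha> < c \<and> sofic {0, 1} (\<Omega> b \<alpha>)" using \<alpha> by blast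
  qed
qed

end
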